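(* Let $c_0\in\mathbb N_0=\{0,1,2,\dots\}$. The set of compact composition operators on $\mathcal H$ with characteristic equal to $c_0$, that is $\{C_\varphi:\ \varphi\in\mathcal G,\ \mathrm{char}(\varphi)=c_0,\ C_\varphi\text{ compact on }\mathcal H\}$, is arcwise connected for the operator norm topology.
   Context: For $\theta\in\mathbb R$, $\mathbb C_\theta=\{s\in\mathbb C:\ \mathrm{Re}\, s>\theta\}$. $\mathcal H$ is the Hilbert space of Dirichlet series $f(s)=\sum_{n\ge1}a_nn^{-s}$ with $\|f\|^2=\sum_n|a_n|^2<\infty$; its elements are analytic on $\mathbb C_{1/2}$. The Gordon-Hedenmalm class $\mathcal G$ is the set of maps $\varphi:\mathbb C_{1/2}\to\mathbb C_{1/2}$ of the form $\varphi(s)=c_0s+\psi(s)$, where $c_0=:\mathrm{char}(\varphi)$ is a non-negative integer (the characteristic of $\varphi$) and $\psi(s)=\sum_{n\ge1}c_nn^{-s}$ converges uniformly in $\mathbb C_\varepsilon$ for every $\varepsilon>0$ and satisfies: (a) if $c_0=0$, then $\psi(\mathbb C_0)\subseteq\mathbb C_{1/2}$; (b) if $c_0\ge1$, then either $\psi\equiv c_1$ with $\mathrm{Re}\,c_1\ge0$ or $\psi(\mathbb C_0)\subseteq\mathbb C_0$. These are exactly the analytic self-maps $\varphi$ of $\mathbb C_{1/2}$ for which $C_\varphi f=f\circ\varphi$ defines a bounded operator on $\mathcal H$. *)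

theory Defs
  imports "HOL-Analysis.Analysis"
begin

definition half_plane :: "real \<Rightarrow> complex set" where
  "half_plane \<theta> = {s. Re s > \<theta>}"

text \<open>The sum runs over \<open>n \<ge> 1\<close>: the term at \<open>n = 0\<close> vanishes because \<open>0 powr z = 0\<close>.\<close>

definition dirichlet_partial_sum :: "(nat \<Rightarrow> complex) \<Rightarrow> nat \<Rightarrow> complex \<Rightarrow> complex" where
  "dirichlet_partial_sum a N s = (\<Sum>n<N. a n * of_nat n powr (- s))"

definition dirichlet_series :: "(nat \<Rightarrow> complex) \<Rightarrow> complex \<Rightarrow> complex" where
  "dirichlet_series a s = (\<Sum>n. a n * of_nat n powr (- s))"

text \<open>An element of the Hilbert space \<open>\<H>\<close> is represented by its coefficient sequence; the
  coordinate 0 is unused and is fixed to be 0, so that the norm is the square root of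
  \<open>\<Sum>n\<ge>1. \<bar>a n\<bar>\<^sup>2\<close>.\<close>

typedef hardy_dirichlet = "{a :: nat \<Rightarrow> complex. a 0 = 0 \<and> summable (\<lambda>n. (cmod (a n))\<^sup>2)}"
  morphisms coeff_hd Abs_hd
  by (rule exI[of _ "\<lambda>_. 0"]) simp

setup_lifting type_definition_hardy_dirichlet

lemma summable_square_add:
  fixes a b :: "nat \<Rightarrow> complex"
  assumes "summable (\<lambda>n. (cmod (a n))\<^sup>2)" "summable (\<lambda>n. (cmod (b n))\<^sup>2)"
  shows "summable (\<lambda>n. (cmod (a n + b n))\<^sup>2)"
proof (rule summable_comparison_test')
  show "summable (\<lambda>n. 2 * (cmod (a n))\<^sup>2 + 2 * (cmod (b n))\<^sup>2)"
    by (intro summable_add summable_mult assms)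
  fix n :: nat
  have "(cmod (a n + b n))\<^sup>2 \<le> (cmod (a n) + cmod (b n))\<^sup>2"
    by (intro power_mono norm_triangle_ineq) simp
  also have "\<dots> \<le> 2 * (cmod (a n))\<^sup>2 + 2 * (cmod (b n))\<^sup>2"
    using sum_squares_bound[of "cmod (a n)" "cmod (b n)"] by (simp add: power2_sum)
  finally show "norm ((cmod (a n + b n))\<^sup>2) \<le> 2 * (cmod (a n))\<^sup>2 + 2 * (cmod (b n))\<^sup>2"
    by simp
qed

lemma summable_square_inner:
  fixes a b :: "nat \<Rightarrow> complex"
  assumes "summable (\<lambda>n. (cmod (a n))\<^sup>2)" "summable (\<lambda>n. (cmod (b n))\<^sup>2)"
  shows "summable (\<lambda>n. a n \<bullet> b n)"
proof (rule summable_comparison_test')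
  show "summable (\<lambda>n. (cmod (a n))\<^sup>2 + (cmod (b n))\<^sup>2)"
    by (intro summable_add assms)
  fix n :: nat
  have "norm (a n \<bullet> b n) \<le> cmod (a n) * cmod (b n)"
    by (simp add: Cauchy_Schwarz_ineq2)
  also have "\<dots> \<le> (cmod (a n))\<^sup>2 + (cmod (b n))\<^sup>2"
    using sum_squares_bound[of "cmod (a n)" "cmod (b n)"]
      mult_nonneg_nonneg[OF norm_ge_zero norm_ge_zero, of "a n" "b n"] by linarith
  finally show "norm (a n \<bullet> b n) \<le> (cmod (a n))\<^sup>2 + (cmod (b n))\<^sup>2" .
qed

instantiation hardy_dirichlet :: real_vector
begin

lift_definition zero_hardy_dirichlet :: hardy_dirichlet is "\<lambda>_. 0"
  by simp

lift_definition plus_hardy_dirichlet :: "hardy_dirichlet \<Rightarrow> hardy_dirichlet \<Rightarrow> hardy_dirichlet"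
  is "\<lambda>a b n. a n + b n"
  by (simp add: summable_square_add)

lift_definition uminus_hardy_dirichlet :: "hardy_dirichlet \<Rightarrow> hardy_dirichlet"
  is "\<lambda>a n. - a n"
  by simp

lift_definition minus_hardy_dirichlet :: "hardy_dirichlet \<Rightarrow> hardy_dirichlet \<Rightarrow> hardy_dirichlet"
  is "\<lambda>a b n. a n - b n"
  subgoal for a b using summable_square_add[of a "\<lambda>n. - b n"] by simp
  done

lift_definition scaleR_hardy_dirichlet :: "real \<Rightarrow> hardy_dirichlet \<Rightarrow> hardy_dirichlet"
  is "\<lambda>r a n. r *\<^sub>R a n"
  by (simp add: norm_mult power_mult_distrib summable_mult)

instance
  by standard (transfer; simp add: fun_eq_iff algebra_simps)+

end

text \<open>The real inner product is the real part of the complex one, so it induces the norm of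
  \<open>\<H>\<close>.\<close>

instantiation hardy_dirichlet :: real_inner
begin

definition inner_hardy_dirichlet :: "hardy_dirichlet \<Rightarrow> hardy_dirichlet \<Rightarrow> real" where
  "inner_hardy_dirichlet f g = (\<Sum>n. coeff_hd f n \<bullet> coeff_hd g n)"

definition norm_hardy_dirichlet :: "hardy_dirichlet \<Rightarrow> real" where
  "norm_hardy_dirichlet f = sqrt (\<Sum>n. (cmod (coeff_hd f n))\<^sup>2)"

definition dist_hardy_dirichlet :: "hardy_dirichlet \<Rightarrow> hardy_dirichlet \<Rightarrow> real" where
  "dist_hardy_dirichlet f g = norm (f - g)"

definition sgn_hardy_dirichlet :: "hardy_dirichlet \<Rightarrow> hardy_dirichlet" where
  "sgn_hardy_dirichlet f = f /\<^sub>R norm f"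

definition uniformity_hardy_dirichlet :: "(hardy_dirichlet \<times> hardy_dirichlet) filter" where
  "uniformity_hardy_dirichlet = (INF e\<in>{0<..}. principal {(f, g). dist f g < e})"

definition open_hardy_dirichlet :: "hardy_dirichlet set \<Rightarrow> bool" where
  "open_hardy_dirichlet U =
     (\<forall>f\<in>U. eventually (\<lambda>(f', g). f' = f \<longrightarrow> g \<in> U) uniformity)"

instance
proof
  fix f g h :: hardy_dirichlet and r :: real and U :: "hardy_dirichlet set"
  have sq: "summable (\<lambda>n. (cmod (coeff_hd f n))\<^sup>2)" for f
    using coeff_hd[of f] by simp
  note inn = summable_square_inner[OF sq sq]
  show "dist f g = norm (f - g)"
    by (rule dist_hardy_dirichlet_def)
  show "sgn f = f /\<^sub>R norm f"
    by (rule sgn_hardy_dirichlet_def)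
  show "(uniformity :: (hardy_dirichlet \<times> hardy_dirichlet) filter)
      = (INF e\<in>{0<..}. principal {(f, g). dist f g < e})"
    by (rule uniformity_hardy_dirichlet_def)
  show "open U = (\<forall>f\<in>U. eventually (\<lambda>(f', g). f' = f \<longrightarrow> g \<in> U) uniformity)"
    by (rule open_hardy_dirichlet_def)
  show "f \<bullet> g = g \<bullet> f"
    by (simp add: inner_hardy_dirichlet_def inner_commute)
  show "(f + g) \<bullet> h = f \<bullet> h + g \<bullet> h"
    by (simp add: inner_hardy_dirichlet_def plus_hardy_dirichlet.rep_eq inner_add_left
        suminf_add[OF inn inn])
  show "(r *\<^sub>R f) \<bullet> g = r * (f \<bullet> g)"
    by (simp add: inner_hardy_dirichlet_def scaleR_hardy_dirichlet.rep_eq suminf_mult[OF inn]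
        del: scaleR_conv_of_real)
  show "0 \<le> f \<bullet> f"
    unfolding inner_hardy_dirichlet_def by (rule suminf_nonneg[OF inn]) simp
  have "f \<bullet> f = 0 \<longleftrightarrow> (\<forall>n. coeff_hd f n \<bullet> coeff_hd f n = 0)"
    unfolding inner_hardy_dirichlet_def by (rule suminf_eq_zero_iff[OF inn]) simp
  also have "\<dots> \<longleftrightarrow> coeff_hd f = coeff_hd 0"
    by (auto simp: zero_hardy_dirichlet.rep_eq fun_eq_iff)
  finally show "f \<bullet> f = 0 \<longleftrightarrow> f = 0"
    by (simp add: coeff_hd_inject)
  show "norm f = sqrt (f \<bullet> f)"
    by (simp add: norm_hardy_dirichlet_def inner_hardy_dirichlet_def power2_norm_eq_inner)
qed

end

lemma summable_coeff_hd: "summable (\<lambda>n. (cmod (coeff_hd f n))\<^sup>2)"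
  using coeff_hd[of f] by simp

lemma norm_hd_square: "(norm f)\<^sup>2 = (\<Sum>n. (cmod (coeff_hd f n))\<^sup>2)"
  unfolding norm_hardy_dirichlet_def
  by (rule real_sqrt_pow2, rule suminf_nonneg[OF summable_coeff_hd]) simp

lemma sum_coeff_hd_le: "(\<Sum>n<N. (cmod (coeff_hd f n))\<^sup>2) \<le> (norm f)\<^sup>2"
  unfolding norm_hd_square by (rule sum_le_suminf[OF summable_coeff_hd]) auto

lemma coeff_hd_le_norm: "cmod (coeff_hd f n) \<le> norm f"
proof -
  have "(cmod (coeff_hd f n))\<^sup>2 \<le> (\<Sum>n<Suc n. (cmod (coeff_hd f n))\<^sup>2)"
    by (simp add: sum_nonneg)
  also note sum_coeff_hd_le
  finally show ?thesis
    by (rule power2_le_imp_le) simp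
qed

instance hardy_dirichlet :: complete_space
proof
  fix X :: "nat \<Rightarrow> hardy_dirichlet"
  assume "Cauchy X"
  have "Cauchy (\<lambda>m. coeff_hd (X m) n)" for n
  proof (rule metric_CauchyI)
    fix e :: real assume "e > 0"
    then obtain M where M: "\<forall>m\<ge>M. \<forall>k\<ge>M. dist (X m) (X k) < e"
      using metric_CauchyD[OF \<open>Cauchy X\<close>] by blast
    have "dist (coeff_hd (X m) n) (coeff_hd (X k) n) \<le> dist (X m) (X k)" for m k
      using coeff_hd_le_norm[of "X m - X k" n]
      by (simp add: dist_norm minus_hardy_dirichlet.rep_eq)
    with M show "\<exists>M. \<forall>m\<ge>M. \<forall>k\<ge>M. dist (coeff_hd (X m) n) (coeff_hd (X k) n) < e"
      by (meson le_less_trans)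
  qed
  then have "\<exists>l. (\<lambda>m. coeff_hd (X m) n) \<longlonglongrightarrow> l" for n
    by (simp add: Cauchy_convergent_iff convergent_def)
  then obtain a where a: "\<And>n. (\<lambda>m. coeff_hd (X m) n) \<longlonglongrightarrow> a n"
    by metis
  have a0: "a 0 = 0"
    using a[of 0] coeff_hd by (simp add: LIMSEQ_const_iff)
  have bound: "\<exists>M. \<forall>m\<ge>M. \<forall>N. (\<Sum>n<N. (cmod (coeff_hd (X m) n - a n))\<^sup>2) \<le> e\<^sup>2"
    if "e > 0" for e :: real
  proof -
    obtain M where M: "\<forall>m\<ge>M. \<forall>k\<ge>M. dist (X m) (X k) < e"
      using metric_CauchyD[OF \<open>Cauchy X\<close> \<open>e > 0\<close>] by blast
    have "(\<Sum>n<N. (cmod (coeff_hd (X m) n - a n))\<^sup>2) \<le> e\<^sup>2" if "m \<ge> M" for m N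
    proof (rule LIMSEQ_le_const2)
      show "(\<lambda>k. \<Sum>n<N. (cmod (coeff_hd (X m) n - coeff_hd (X k) n))\<^sup>2)
          \<longlonglongrightarrow> (\<Sum>n<N. (cmod (coeff_hd (X m) n - a n))\<^sup>2)"
        by (intro tendsto_intros a)
      have "(\<Sum>n<N. (cmod (coeff_hd (X m) n - coeff_hd (X k) n))\<^sup>2) \<le> e\<^sup>2" if "k \<ge> M" for k
      proof -
        have "(\<Sum>n<N. (cmod (coeff_hd (X m) n - coeff_hd (X k) n))\<^sup>2) \<le> (norm (X m - X k))\<^sup>2"
          using sum_coeff_hd_le[where f = "X m - X k" and N = N]
          by (simp add: minus_hardy_dirichlet.rep_eq)
        also have "\<dots> \<le> e\<^sup>2"
          using M \<open>m \<ge> M\<close> \<open>k \<ge> M\<close> by (intro power_mono) (auto simp: dist_norm less_imp_le)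
        finally show ?thesis .
      qed
      then show "\<exists>K. \<forall>k\<ge>K. (\<Sum>n<N. (cmod (coeff_hd (X m) n - coeff_hd (X k) n))\<^sup>2) \<le> e\<^sup>2"
        by blast
    qed
    then show ?thesis by blast
  qed
  obtain M where M: "\<And>N. (\<Sum>n<N. (cmod (coeff_hd (X M) n - a n))\<^sup>2) \<le> 1\<^sup>2"
    using bound[of 1] by auto
  have "summable (\<lambda>n. (cmod (coeff_hd (X M) n - a n))\<^sup>2)"
    by (rule bounded_imp_summable[of _ 1])
      (use M[of "Suc _"] in \<open>auto simp: lessThan_Suc_atMost\<close>)
  then have "summable (\<lambda>n. (cmod (a n - coeff_hd (X M) n))\<^sup>2)"
    by (simp add: norm_minus_commute)
  from summable_square_add[OF this summable_coeff_hd[of "X M"]]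
  have suma: "summable (\<lambda>n. (cmod (a n))\<^sup>2)"
    by simp
  define f where "f = Abs_hd a"
  have f: "coeff_hd f = a"
    using a0 suma by (simp add: f_def Abs_hd_inverse)
  have "X \<longlonglongrightarrow> f"
  proof (rule metric_LIMSEQ_I)
    fix e :: real assume "e > 0"
    obtain M where M: "\<And>m N. m \<ge> M \<Longrightarrow>
        (\<Sum>n<N. (cmod (coeff_hd (X m) n - a n))\<^sup>2) \<le> (e / 2)\<^sup>2"
      using bound[of "e / 2"] \<open>e > 0\<close> by auto
    have "dist (X m) f < e" if "m \<ge> M" for m
    proof -
      have "(norm (X m - f))\<^sup>2 \<le> (e / 2)\<^sup>2"
        unfolding norm_hd_square
        by (rule suminf_le_const[OF summable_coeff_hd])
          (use M[OF that] in \<open>simp add: minus_hardy_dirichlet.rep_eq f\<close>)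
      then have "norm (X m - f) \<le> e / 2"
        by (rule power2_le_imp_le) (use \<open>e > 0\<close> in simp)
      with \<open>e > 0\<close> show ?thesis
        by (simp add: dist_norm)
    qed
    then show "\<exists>M. \<forall>m\<ge>M. dist (X m) f < e"
      by blast
  qed
  then show "convergent X"
    by (auto simp: convergent_def)
qed

instance hardy_dirichlet :: banach ..

text \<open>The function on \<open>half_plane (1/2)\<close> given by an element of \<open>\<H>\<close>.\<close>

definition eval_hd :: "hardy_dirichlet \<Rightarrow> complex \<Rightarrow> complex" where
  "eval_hd f s = dirichlet_series (coeff_hd f) s"

text \<open>\<open>gordon_hedenmalm_form c0 \<phi>\<close>: the map \<open>\<phi>\<close> has a representation
  \<open>\<phi> s = c0 * s + \<psi> s\<close> as required in the Gordon--Hedenmalm class. Only the values of \<open>\<phi>\<close>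
  on \<open>half_plane (1/2)\<close> are relevant. A constant \<open>\<psi>\<close> equals its coefficient \<open>c 1\<close>.\<close>

definition gordon_hedenmalm_form :: "nat \<Rightarrow> (complex \<Rightarrow> complex) \<Rightarrow> bool" where
  "gordon_hedenmalm_form c0 \<phi> \<longleftrightarrow>
     \<phi> ` half_plane (1/2) \<subseteq> half_plane (1/2) \<and>
     (\<exists>c :: nat \<Rightarrow> complex.
        (\<forall>\<epsilon>>0. uniformly_convergent_on (half_plane \<epsilon>) (dirichlet_partial_sum c)) \<and>
        (\<forall>s\<in>half_plane (1/2). \<phi> s = of_nat c0 * s + dirichlet_series c s) \<and>
        (c0 = 0 \<longrightarrow> dirichlet_series c ` half_plane 0 \<subseteq> half_plane (1/2)) \<and>
        (c0 \<ge> 1 \<longrightarrow>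
           ((\<forall>s\<in>half_plane 0. dirichlet_series c s = c 1) \<and> Re (c 1) \<ge> 0) \<or>
           dirichlet_series c ` half_plane 0 \<subseteq> half_plane 0))"

definition gordon_hedenmalm :: "(complex \<Rightarrow> complex) set" where
  "gordon_hedenmalm = {\<phi>. \<exists>c0. gordon_hedenmalm_form c0 \<phi>}"

definition characteristic :: "(complex \<Rightarrow> complex) \<Rightarrow> nat" where
  "characteristic \<phi> = (THE c0. gordon_hedenmalm_form c0 \<phi>)"

lemma bounded_dirichlet_partial_sum:
  assumes "\<epsilon> > 0"
  shows "bounded (dirichlet_partial_sum c N ` half_plane \<epsilon>)"
proof -
  have "cmod (dirichlet_partial_sum c N s) \<le> (\<Sum>n<N. cmod (c n))" if "s \<in> half_plane \<epsilon>" for s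
  proof -
    have "cmod (c n * of_nat n powr (- s)) \<le> cmod (c n)" for n
    proof (cases "n = 0")
      case False
      have "cmod (of_nat n powr (- s)) = real n powr (- Re s)"
        using norm_powr_real_powr[of "of_nat n" "- s"] False by simp
      also have "\<dots> \<le> real n powr 0"
        using False that assms by (intro powr_mono) (auto simp: half_plane_def)
      finally have "cmod (of_nat n powr (- s)) \<le> 1"
        using False by simp
      then show ?thesis
        by (simp add: norm_mult mult_left_le)
    qed simp
    then show ?thesis
      unfolding dirichlet_partial_sum_def by (intro sum_norm_le)
  qed
  then show ?thesis
    unfolding bounded_iff by blast
qed

lemma bounded_dirichlet_series:
  assumes "uniformly_convergent_on (half_plane \<epsilon>) (dirichlet_partial_sum c)" "\<epsilon> > 0"
  shows "\<exists>B. \<forall>s\<in>half_plane \<epsilon>. cmod (dirichlet_series c s) \<le> B"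
proof -
  obtain l where l: "uniform_limit (half_plane \<epsilon>) (dirichlet_partial_sum c) l sequentially"
    using assms(1) by (auto simp: uniformly_convergent_on_def)
  have eq: "dirichlet_series c s = l s" if "s \<in> half_plane \<epsilon>" for s
  proof -
    have "(\<lambda>n. dirichlet_partial_sum c n s) \<longlonglongrightarrow> l s"
      using tendsto_uniform_limitI[OF l that] .
    then have "(\<lambda>n. c n * of_nat n powr (- s)) sums l s"
      by (simp add: sums_def dirichlet_partial_sum_def)
    then show ?thesis
      by (simp add: dirichlet_series_def sums_iff)
  qed
  have "bounded (l ` half_plane \<epsilon>)"
    by (rule uniform_limit_bounded[OF l])
      (simp_all add: bounded_dirichlet_partial_sum[OF assms(2)])
  then show ?thesis
    unfolding bounded_iff using eq by auto
qed

lemma gordon_hedenmalm_form_unique: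
  assumes "gordon_hedenmalm_form c \<phi>" "gordon_hedenmalm_form d \<phi>"
  shows "c = d"
proof (rule ccontr)
  assume "c \<noteq> d"
  have *: "\<exists>B. \<forall>s\<in>half_plane (1/2). cmod (\<phi> s - of_nat c * s) \<le> B"
    if c: "gordon_hedenmalm_form c \<phi>" for c
  proof -
    obtain u where
      u: "\<forall>\<epsilon>>0. uniformly_convergent_on (half_plane \<epsilon>) (dirichlet_partial_sum u)"
         "\<forall>s\<in>half_plane (1/2). \<phi> s = of_nat c * s + dirichlet_series u s"
      using c unfolding gordon_hedenmalm_form_def by blast
    have "uniformly_convergent_on (half_plane (1/2)) (dirichlet_partial_sum u)"
      using u(1) by simp
    from bounded_dirichlet_series[OF this] u(2) show ?thesis
      by auto
  qed
  obtain A where A: "\<And>s. s \<in> half_plane (1/2) \<Longrightarrow> cmod (\<phi> s - of_nat c * s) \<le> A"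
    using *[OF assms(1)] by blast
  obtain B where B: "\<And>s. s \<in> half_plane (1/2) \<Longrightarrow> cmod (\<phi> s - of_nat d * s) \<le> B"
    using *[OF assms(2)] by blast
  define s :: complex where "s = of_real (\<bar>A\<bar> + \<bar>B\<bar> + 1)"
  have s: "s \<in> half_plane (1/2)"
    by (simp add: s_def half_plane_def)
  have "1 \<le> \<bar>real d - real c\<bar>"
    using \<open>c \<noteq> d\<close> by linarith
  then have "\<bar>A\<bar> + \<bar>B\<bar> + 1 \<le> \<bar>real d - real c\<bar> * (\<bar>A\<bar> + \<bar>B\<bar> + 1)"
    using mult_right_mono[of 1 "\<bar>real d - real c\<bar>" "\<bar>A\<bar> + \<bar>B\<bar> + 1"] by simp
  also have "\<dots> = cmod (of_real (real d - real c) * s)"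
    unfolding norm_mult s_def norm_of_real by simp
  also have "of_real (real d - real c) * s = (\<phi> s - of_nat c * s) - (\<phi> s - of_nat d * s)"
    by (simp add: algebra_simps)
  also have "cmod \<dots> \<le> A + B"
    using norm_triangle_ineq4[of "\<phi> s - of_nat c * s" "\<phi> s - of_nat d * s"] A[OF s] B[OF s]
    by linarith
  finally show False
    by linarith
qed

lemma characteristic_eq: "gordon_hedenmalm_form c0 \<phi> \<Longrightarrow> characteristic \<phi> = c0"
  unfolding characteristic_def using gordon_hedenmalm_form_unique by blast

text \<open>\<open>is_composition_operator \<phi> T\<close> says that \<open>T\<close> is the operator \<open>f \<mapsto> f \<circ> \<phi>\<close>, where the
  elements of \<open>\<H>\<close> are viewed as functions on \<open>half_plane (1/2)\<close>. Such a \<open>T\<close> is unique,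
  because a Dirichlet series is determined by its values there. Bounded maps are
  real-linear in the library; composition operators are automatically complex-linear, and the
  operator norm is the same.\<close>

definition is_composition_operator ::
    "(complex \<Rightarrow> complex) \<Rightarrow> (hardy_dirichlet \<Rightarrow>\<^sub>L hardy_dirichlet) \<Rightarrow> bool" where
  "is_composition_operator \<phi> T \<longleftrightarrow>
     (\<forall>f. \<forall>s\<in>half_plane (1/2). eval_hd (blinfun_apply T f) s = eval_hd f (\<phi> s))"

definition compact_operator ::
    "('a::real_normed_vector \<Rightarrow>\<^sub>L 'b::real_normed_vector) \<Rightarrow> bool" where
  "compact_operator T \<longleftrightarrow> compact (closure (blinfun_apply T ` cball 0 1))"

definition compact_composition_operators ::
    "nat \<Rightarrow> (hardy_dirichlet \<Rightarrow>\<^sub>L hardy_dirichlet) set" where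
  "compact_composition_operators c0 =
     {T. \<exists>\<phi>\<in>gordon_hedenmalm. characteristic \<phi> = c0 \<and> is_composition_operator \<phi> T \<and>
           compact_operator T}"

end

theory Submission
  imports Defs
begin

text \<open>Let \<open>T\<^sub>t\<close> be the diagonal contraction multiplying the \<open>n\<close>-th coefficient by \<open>n powr -t\<close>, so
  that \<open>T\<^sub>t f s = f (s + t)\<close> and \<open>T\<^sub>t C\<^sub>\<phi> T\<^sub>t\<close> is the composition operator with symbol
  \<open>\<phi> (s + t) + t\<close>. Every compact composition operator of characteristic \<open>c0\<close> can be
  joined to the one with symbol \<open>c0 * s + 2\<close>, in two moves.

  First move: let \<open>t\<close> run from 0 to 2 in \<open>T\<^sub>t C\<^sub>\<phi> T\<^sub>t\<close>. The family \<open>T\<^sub>t\<close> is only strongly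
  continuous at 0, but it is contractive and self-adjoint, and strong convergence of contractions
  becomes norm convergence after multiplication by a compact operator \<open>K\<close>: on the left because
  \<open>K\<close> maps the unit ball into the neighbourhood of a finite set, on the right by the same argument
  after passing to the other side of the inner product (\<open>continuous_on_compression\<close>). The
  left factor makes the additive part of the symbol bounded, and the right one moves it away from the
  boundary line.

  Second move: the symbol is now \<open>c0 * s + D s + 2\<close>, where on the right half-plane \<open>D\<close> is a
  uniform limit of Dirichlet polynomials, hence bounded, and \<open>Re D \<ge> 0\<close>. Contract \<open>D\<close> linearly
  to 0. The operators along this path are bounded, compact and norm-continuous in the parameter
  because, formally, \<open>C f = (\<Sum>n. a\<^sub>n * h\<^sub>n)\<close> with
  \<open>h\<^sub>n s = n powr - \<phi> s\<close>, and \<open>h\<^sub>n\<close> is bounded by \<open>n powr -2\<close> on the right half-plane. Since the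
  norm of \<open>\<H>\<close> is at most the supremum norm there, the series is an absolutely convergent series
  of rank-one operators, and the Weierstrass test applies (\<open>composition_operator_family\<close>).

  The inequality between the two norms (\<open>norm_le_sup_half_plane\<close>) is the one analytic
  ingredient. It also shows that an element of \<open>\<H>\<close> is determined by its values, so that
  the ends of the paths, known as operators with the same symbol, fit together
  (\<open>composition_operator_unique\<close>).\<close>

section \<open>Monomials, truncations and vertical translations\<close>

lift_definition monomial_hd :: "complex \<Rightarrow> nat \<Rightarrow> hardy_dirichlet"
  is "\<lambda>z m n. if n = m \<and> m \<noteq> 0 then z else 0"
proof safe
  fix z :: complex and m :: nat
  show "summable (\<lambda>n. (cmod (if n = m \<and> m \<noteq> 0 then z else 0))\<^sup>2)"
    by (rule summable_finite[of "{m}"]) auto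
qed auto

lift_definition truncate_hd :: "nat \<Rightarrow> hardy_dirichlet \<Rightarrow> hardy_dirichlet"
  is "\<lambda>N a n. if n < N then a n else 0"
proof safe
  fix N and a :: "nat \<Rightarrow> complex"
  show "summable (\<lambda>n. (cmod (if n < N then a n else 0))\<^sup>2)"
    by (rule summable_finite[of "{..<N}"]) auto
qed auto

lemma powr_minus_abs_le_1: "real n powr - \<bar>t\<bar> \<le> 1"
proof (cases "n = 0")
  case False
  then have "real n powr - \<bar>t\<bar> \<le> real n powr 0"
    by (intro powr_mono) auto
  with False show ?thesis by simp
qed simp

text \<open>The absolute value makes the family total in \<open>t\<close>, and continuous on the whole line.\<close>

lift_definition translate_hd :: "real \<Rightarrow> hardy_dirichlet \<Rightarrow> hardy_dirichlet"
  is "\<lambda>t a n. (real n powr - \<bar>t\<bar>) *\<^sub>R a n"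
proof safe
  fix t and a :: "nat \<Rightarrow> complex"
  assume a: "summable (\<lambda>n. (cmod (a n))\<^sup>2)"
  show "summable (\<lambda>n. (cmod ((real n powr - \<bar>t\<bar>) *\<^sub>R a n))\<^sup>2)"
  proof (rule summable_comparison_test'[OF a])
    fix n
    show "norm ((cmod ((real n powr - \<bar>t\<bar>) *\<^sub>R a n))\<^sup>2) \<le> (cmod (a n))\<^sup>2"
      using powr_minus_abs_le_1[of n t] by (simp add: mult_left_le_one_le power_mono)
  qed
qed auto

lift_definition cscale_hd :: "complex \<Rightarrow> hardy_dirichlet \<Rightarrow> hardy_dirichlet"
  is "\<lambda>z a n. z * a n"
  by (simp add: norm_mult power_mult_distrib summable_mult)

lemma hd_eqI: "(\<And>n. coeff_hd f n = coeff_hd g n) \<Longrightarrow> f = g"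
  using coeff_hd_inject by blast

lemma coeff_hd_0 [simp]: "coeff_hd f 0 = 0"
  using coeff_hd[of f] by simp

lemmas coeff_hd_simps [simp] =
  zero_hardy_dirichlet.rep_eq plus_hardy_dirichlet.rep_eq minus_hardy_dirichlet.rep_eq
  uminus_hardy_dirichlet.rep_eq scaleR_hardy_dirichlet.rep_eq monomial_hd.rep_eq
  truncate_hd.rep_eq translate_hd.rep_eq cscale_hd.rep_eq

lemma coeff_hd_sum [simp]: "coeff_hd (sum F A) n = (\<Sum>i\<in>A. coeff_hd (F i) n)"
  by (induction A rule: infinite_finite_induct) auto

lemma norm_hd_le_of_partial:
  assumes "B \<ge> 0" "\<And>N. (\<Sum>n<N. (cmod (coeff_hd f n))\<^sup>2) \<le> B\<^sup>2"
  shows "norm f \<le> B"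
proof (rule power2_le_imp_le)
  show "(norm f)\<^sup>2 \<le> B\<^sup>2"
    unfolding norm_hd_square by (rule suminf_le_const[OF summable_coeff_hd]) (use assms in auto)
qed fact

lemma norm_hd_mono:
  assumes "\<And>n. cmod (coeff_hd f n) \<le> cmod (coeff_hd g n)"
  shows "norm f \<le> norm g"
proof (rule norm_hd_le_of_partial)
  fix N
  have "(\<Sum>n<N. (cmod (coeff_hd f n))\<^sup>2) \<le> (\<Sum>n<N. (cmod (coeff_hd g n))\<^sup>2)"
    by (intro sum_mono power_mono assms) auto
  also have "\<dots> \<le> (norm g)\<^sup>2" by (rule sum_coeff_hd_le)
  finally show "(\<Sum>n<N. (cmod (coeff_hd f n))\<^sup>2) \<le> (norm g)\<^sup>2" .
qed simp

lemma norm_cscale_hd: "norm (cscale_hd z f) = cmod z * norm f"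
  unfolding norm_hardy_dirichlet_def
  by (simp add: norm_mult power_mult_distrib suminf_mult[OF summable_coeff_hd] real_sqrt_mult)

lemma bounded_bilinear_cscale_hd: "bounded_bilinear cscale_hd"
  by (rule bounded_bilinear.intro)
    (auto intro!: hd_eqI exI[of _ 1] simp: norm_cscale_hd algebra_simps)

lemma bounded_linear_coeff_hd: "bounded_linear (\<lambda>f. coeff_hd f n)"
  by (rule bounded_linear_intro[of _ 1]) (auto simp: coeff_hd_le_norm)

lemma norm_translate_hd_le: "norm (translate_hd t f) \<le> norm f"
  by (rule norm_hd_mono) (simp add: mult_left_le_one_le powr_minus_abs_le_1)

lemma bounded_linear_translate_hd: "bounded_linear (translate_hd t)"
  by (rule bounded_linear_intro[of _ 1])
    (auto intro!: hd_eqI simp: norm_translate_hd_le algebra_simps)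

lemma truncate_hd_eq_sum: "truncate_hd N f = (\<Sum>n<N. monomial_hd (coeff_hd f n) n)"
proof (rule hd_eqI)
  fix n
  have "(\<Sum>m<N. coeff_hd (monomial_hd (coeff_hd f m) m) n) = (\<Sum>m<N. if m = n then coeff_hd f n else 0)"
    by (intro sum.cong) auto
  then show "coeff_hd (truncate_hd N f) n = coeff_hd (\<Sum>n<N. monomial_hd (coeff_hd f n) n) n"
    by simp
qed

lemma norm_truncate_hd_square: "(norm (truncate_hd N f))\<^sup>2 = (\<Sum>n<N. (cmod (coeff_hd f n))\<^sup>2)"
proof -
  have "(norm (truncate_hd N f))\<^sup>2 = (\<Sum>n<N. (cmod (coeff_hd (truncate_hd N f) n))\<^sup>2)"
    unfolding norm_hd_square by (rule suminf_finite) auto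
  then show ?thesis by simp
qed

lemma norm_diff_truncate_hd_square:
  "(norm (f - truncate_hd N f))\<^sup>2 = (norm f)\<^sup>2 - (\<Sum>n<N. (cmod (coeff_hd f n))\<^sup>2)"
proof -
  have "(\<Sum>n. (cmod (coeff_hd (f - truncate_hd N f) n))\<^sup>2)
      = (\<Sum>n. (cmod (coeff_hd f n))\<^sup>2 - (cmod (coeff_hd (truncate_hd N f) n))\<^sup>2)"
    by (intro suminf_cong) auto
  also have "\<dots> = (norm f)\<^sup>2 - (norm (truncate_hd N f))\<^sup>2"
    unfolding norm_hd_square by (rule suminf_diff[symmetric]; rule summable_coeff_hd)
  finally show ?thesis
    unfolding norm_hd_square[of "f - truncate_hd N f"] norm_truncate_hd_square .
qed

lemma truncate_hd_tendsto: "(\<lambda>N. truncate_hd N f) \<longlonglongrightarrow> f"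
proof -
  have "(\<lambda>N. (norm f)\<^sup>2 - (\<Sum>n<N. (cmod (coeff_hd f n))\<^sup>2)) \<longlonglongrightarrow> (norm f)\<^sup>2 - (norm f)\<^sup>2"
    using summable_LIMSEQ[OF summable_coeff_hd[of f]]
    by (intro tendsto_intros) (simp add: norm_hd_square)
  then have "(\<lambda>N. (norm (f - truncate_hd N f))\<^sup>2) \<longlonglongrightarrow> 0"
    by (simp add: norm_diff_truncate_hd_square)
  then have "(\<lambda>N. sqrt ((norm (f - truncate_hd N f))\<^sup>2)) \<longlonglongrightarrow> sqrt 0"
    by (rule tendsto_real_sqrt)
  then have "(\<lambda>N. norm (f - truncate_hd N f)) \<longlonglongrightarrow> 0"
    by (simp only: real_sqrt_abs abs_norm_cancel real_sqrt_zero)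
  then have "(\<lambda>N. f - truncate_hd N f) \<longlonglongrightarrow> 0"
    by (rule tendsto_norm_zero_cancel)
  from tendsto_diff[OF tendsto_const[of f] this] show ?thesis by simp
qed

lemma translate_hd_truncate: "translate_hd t (truncate_hd N f) =
    (\<Sum>n<N. (real n powr - \<bar>t\<bar>) *\<^sub>R monomial_hd (coeff_hd f n) n)"
proof -
  interpret bounded_linear "translate_hd t" by (rule bounded_linear_translate_hd)
  show ?thesis
    unfolding truncate_hd_eq_sum sum by (intro sum.cong hd_eqI) auto
qed

text \<open>On truncations the orbit is a finite sum of continuous terms, and because translations
  are contractions the truncation error is uniform in \<open>t\<close>.\<close>

lemma continuous_on_translate_hd: "continuous_on UNIV (\<lambda>t. translate_hd t f)"
proof (rule uniform_limit_theorem)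
  show "\<forall>\<^sub>F N in sequentially. continuous_on UNIV (\<lambda>t. translate_hd t (truncate_hd N f))"
  proof (rule always_eventually, rule allI)
    fix N
    have "continuous_on UNIV (\<lambda>t. real n powr - \<bar>t\<bar>)" for n
      by (cases "n = 0") (auto intro!: continuous_intros)
    then show "continuous_on UNIV (\<lambda>t. translate_hd t (truncate_hd N f))"
      unfolding translate_hd_truncate by (intro continuous_on_sum continuous_on_scaleR) auto
  qed
  show "uniform_limit UNIV (\<lambda>N t. translate_hd t (truncate_hd N f)) (\<lambda>t. translate_hd t f) sequentially"
  proof (rule uniform_limitI)
    fix e :: real assume "e > 0"
    have "dist (translate_hd t (truncate_hd N f)) (translate_hd t f) \<le> dist (truncate_hd N f) f" for N t
      using norm_translate_hd_le[of t "truncate_hd N f - f"]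
        bounded_linear.linear[OF bounded_linear_translate_hd[of t]]
      by (simp add: dist_norm linear_diff)
    then have "dist (truncate_hd N f) f < e \<Longrightarrow>
        \<forall>t\<in>UNIV. dist (translate_hd t (truncate_hd N f)) (translate_hd t f) < e" for N
      using le_less_trans by blast
    then show "\<forall>\<^sub>F N in sequentially. \<forall>t\<in>UNIV.
        dist (translate_hd t (truncate_hd N f)) (translate_hd t f) < e"
      by (rule eventually_mono[OF tendstoD[OF truncate_hd_tendsto[of f] \<open>e > 0\<close>]])
  qed
qed simp

lemma inner_translate_hd: "inner (translate_hd t f) g = inner f (translate_hd t g)"
  by (simp add: inner_hardy_dirichlet_def)

lemma translate_hd_0 [simp]: "translate_hd 0 f = f"
proof (rule hd_eqI)
  fix n show "coeff_hd (translate_hd 0 f) n = coeff_hd f n"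
    by (cases "n = 0") auto
qed

text \<open>The vector is read off from the values of the functional on the real orthonormal basis formed
  by the monomials with coefficients \<open>1\<close> and \<open>\<i>\<close>; testing the functional on
  the truncations of this candidate bounds their norms. Only real-linearity is assumed, which is all
  that a bounded linear map provides here.\<close>

lemma Riesz_representation_hd:
  fixes k :: "hardy_dirichlet \<Rightarrow> real"
  assumes "bounded_linear k"
  shows "\<exists>v. \<forall>f. k f = inner f v"
proof -
  interpret bounded_linear k by fact
  define w where "w n = Complex (k (monomial_hd 1 n)) (k (monomial_hd \<i> n))" for n
  have mono: "k (monomial_hd z n) = inner z (w n)" for z n
  proof -
    have "monomial_hd z n = Re z *\<^sub>R monomial_hd 1 n + Im z *\<^sub>R monomial_hd \<i> n"
      by (rule hd_eqI) (auto simp: complex_eq_iff)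
    then show ?thesis by (simp add: add scaleR w_def inner_complex_def)
  qed
  obtain K where K: "\<And>f. norm (k f) \<le> norm f * K" using bounded by blast
  have w0: "w 0 = 0"
  proof -
    have "monomial_hd z 0 = 0" for z by (rule hd_eqI) auto
    then show ?thesis by (simp add: w_def zero complex_eq_iff)
  qed
  \<comment> \<open>Evaluate \<open>k\<close> at the truncation \<open>g\<close> of the candidate, where \<open>k g = (norm g)\<^sup>2\<close>.\<close>
  have part: "(\<Sum>n<N. (cmod (w n))\<^sup>2) \<le> K\<^sup>2" for N
  proof -
    define g where "g = (\<Sum>n<N. monomial_hd (w n) n)"
    have cg: "coeff_hd g n = (if n < N then w n else 0)" for n
    proof -
      have "coeff_hd g n = (\<Sum>m<N. if m = n then w n else 0)"
        unfolding g_def coeff_hd_sum using w0 by (intro sum.cong) auto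
      then show ?thesis by simp
    qed
    have ng: "(norm g)\<^sup>2 = (\<Sum>n<N. (cmod (w n))\<^sup>2)"
      unfolding norm_hd_square cg by (subst suminf_finite[of "{..<N}"]) (auto intro!: sum.cong)
    have "k g = (norm g)\<^sup>2"
      unfolding ng unfolding g_def sum mono by (simp add: power2_norm_eq_inner)
    with K[of g] have "norm g * norm g \<le> norm g * K"
      by (simp add: power2_eq_square)
    then have "norm g \<le> K \<or> norm g = 0"
      by (metis mult_le_cancel_left_pos norm_ge_zero order_less_le)
    then have "(norm g)\<^sup>2 \<le> K\<^sup>2"
      by (auto intro: power_mono)
    with ng show ?thesis by simp
  qed
  have "summable (\<lambda>n. (cmod (w n))\<^sup>2)"
    by (rule bounded_imp_summable[of _ "K\<^sup>2"])
      (use part[of "Suc _"] in \<open>auto simp: lessThan_Suc_atMost\<close>)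
  then have cw: "coeff_hd (Abs_hd w) = w"
    using w0 by (simp add: Abs_hd_inverse)
  have "k f = inner f (Abs_hd w)" for f
  proof (rule LIMSEQ_unique)
    show "(\<lambda>N. k (truncate_hd N f)) \<longlonglongrightarrow> k f"
      by (intro tendsto truncate_hd_tendsto)
    have "k (truncate_hd N f) = inner (truncate_hd N f) (Abs_hd w)" for N
    proof -
      have "k (truncate_hd N f) = (\<Sum>n<N. inner (coeff_hd f n) (w n))"
        by (simp add: truncate_hd_eq_sum sum mono)
      also have "\<dots> = inner (truncate_hd N f) (Abs_hd w)"
        unfolding inner_hardy_dirichlet_def cw
        by (subst suminf_finite[of "{..<N}"]) auto
      finally show ?thesis .
    qed
    then show "(\<lambda>N. k (truncate_hd N f)) \<longlonglongrightarrow> inner f (Abs_hd w)"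
      using tendsto_inner[OF truncate_hd_tendsto tendsto_const] by simp
  qed
  then show ?thesis by blast
qed

section \<open>Point evaluations\<close>

lemma norm_of_nat_powr: "cmod (of_nat n powr z) = real n powr Re z"
  using norm_powr_real_powr[of "of_nat n" z] by simp

text \<open>Cauchy--Schwarz against the square-summable sequence \<open>n powr -\<sigma>\<close>. The bound depends on
  \<open>s\<close> only through a lower bound for \<open>Re s\<close>; this uniformity is what the uniqueness theorem needs.\<close>

lemma sum_norm_eval_hd_le:
  assumes "Re s \<ge> \<sigma>" "\<sigma> > 1/2"
  shows "(\<Sum>n<N. cmod (coeff_hd f n * of_nat n powr (- s)))
       \<le> norm f * sqrt (\<Sum>n. real n powr (-2 * \<sigma>))"
proof -
  have "(\<Sum>n<N. cmod (coeff_hd f n * of_nat n powr (- s)))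
      \<le> (\<Sum>n<N. \<bar>cmod (coeff_hd f n)\<bar> * \<bar>real n powr (- \<sigma>)\<bar>)"
  proof (rule sum_mono)
    fix n
    have "real n powr (- Re s) \<le> real n powr (- \<sigma>)"
      by (cases "n = 0") (use assms in \<open>auto intro!: powr_mono\<close>)
    then show "cmod (coeff_hd f n * of_nat n powr (- s))
        \<le> \<bar>cmod (coeff_hd f n)\<bar> * \<bar>real n powr (- \<sigma>)\<bar>"
      by (simp add: norm_mult norm_of_nat_powr mult_left_mono)
  qed
  also have "\<dots> \<le> L2_set (\<lambda>n. cmod (coeff_hd f n)) {..<N} * L2_set (\<lambda>n. real n powr (- \<sigma>)) {..<N}"
    by (rule L2_set_mult_ineq)
  also have "\<dots> \<le> norm f * sqrt (\<Sum>n. real n powr (-2 * \<sigma>))"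
  proof (intro mult_mono)
    show "L2_set (\<lambda>n. cmod (coeff_hd f n)) {..<N} \<le> norm f"
      unfolding L2_set_def by (rule real_le_lsqrt) (auto intro: sum_nonneg sum_coeff_hd_le)
    have "(\<Sum>n<N. (real n powr (- \<sigma>))\<^sup>2) = (\<Sum>n<N. real n powr (-2 * \<sigma>))"
      by (intro sum.cong) (auto simp: power2_eq_square simp flip: powr_add)
    also have "\<dots> \<le> (\<Sum>n. real n powr (-2 * \<sigma>))"
      using assms by (intro sum_le_suminf) (auto simp: summable_real_powr_iff)
    finally show "L2_set (\<lambda>n. real n powr (- \<sigma>)) {..<N} \<le> sqrt (\<Sum>n. real n powr (-2 * \<sigma>))"
      unfolding L2_set_def by simp
  qed auto
  finally show ?thesis .
qed

lemma summable_eval_hd: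
  assumes "Re s > 1/2"
  shows "summable (\<lambda>n. cmod (coeff_hd f n * of_nat n powr (- s)))"
proof (rule bounded_imp_summable)
  fix N
  show "(\<Sum>n\<le>N. cmod (coeff_hd f n * of_nat n powr (- s)))
      \<le> norm f * sqrt (\<Sum>n. real n powr (-2 * Re s))"
    using sum_norm_eval_hd_le[OF order_refl assms, where f = f and N = "Suc N"]
    unfolding lessThan_Suc_atMost .
qed simp

lemma norm_eval_hd_le:
  assumes "Re s \<ge> \<sigma>" "\<sigma> > 1/2"
  shows "cmod (eval_hd f s) \<le> norm f * sqrt (\<Sum>n. real n powr (-2 * \<sigma>))"
proof -
  have sm: "summable (\<lambda>n. cmod (coeff_hd f n * of_nat n powr (- s)))"
    using assms by (intro summable_eval_hd) auto
  have "cmod (eval_hd f s) \<le> (\<Sum>n. cmod (coeff_hd f n * of_nat n powr (- s)))"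
    unfolding eval_hd_def dirichlet_series_def by (rule summable_norm[OF sm])
  also have "\<dots> \<le> norm f * sqrt (\<Sum>n. real n powr (-2 * \<sigma>))"
    by (rule suminf_le_const[OF sm sum_norm_eval_hd_le[OF assms]])
  finally show ?thesis .
qed

lemma bounded_linear_eval_hd:
  assumes "Re s > 1/2"
  shows "bounded_linear (\<lambda>f. eval_hd f s)"
proof (rule bounded_linear_intro)
  note sm = summable_norm_cancel[OF summable_eval_hd[OF assms]]
  fix f g :: hardy_dirichlet and r :: real
  show "eval_hd (f + g) s = eval_hd f s + eval_hd g s"
    unfolding eval_hd_def dirichlet_series_def suminf_add[OF sm sm]
    by (simp add: algebra_simps)
  show "eval_hd (r *\<^sub>R f) s = r *\<^sub>R eval_hd f s"
    unfolding eval_hd_def dirichlet_series_def suminf_scaleR_right[OF sm]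
    by simp
  show "norm (eval_hd f s) \<le> norm f * sqrt (\<Sum>n. real n powr (-2 * Re s))"
    using assms by (intro norm_eval_hd_le) auto
qed

lemma eval_cscale_hd:
  assumes "Re s > 1/2"
  shows "eval_hd (cscale_hd z f) s = z * eval_hd f s"
  unfolding eval_hd_def dirichlet_series_def
    suminf_mult[OF summable_norm_cancel[OF summable_eval_hd[OF assms]], symmetric]
  by (simp add: mult.assoc)

lemma of_nat_powr_minus_add_of_real:
  "of_nat n powr - (s + of_real t) = (of_real (real n powr - t) * of_nat n powr - s :: complex)"
proof -
  have "of_nat n powr - (s + of_real t) = (of_nat n powr (of_real (- t)) * of_nat n powr - s :: complex)"
    by (simp add: powr_add[symmetric] add.commute)
  also have "(of_nat n powr (of_real (- t)) :: complex) = of_real (real n powr - t)"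
    using powr_of_real[of "real n" "- t"] by simp
  finally show ?thesis .
qed

lemma eval_translate_hd:
  assumes "t \<ge> 0"
  shows "eval_hd (translate_hd t f) s = eval_hd f (s + of_real t)"
  unfolding eval_hd_def dirichlet_series_def of_nat_powr_minus_add_of_real
  using assms by (simp add: scaleR_conv_of_real mult_ac)

section \<open>Dirichlet polynomials\<close>

definition dirichlet_polynomials :: "hardy_dirichlet set" where
  "dirichlet_polynomials = {f. \<exists>N. \<forall>n\<ge>N. coeff_hd f n = 0}"

lemma dirichlet_polynomialsI: "(\<And>n. n \<ge> N \<Longrightarrow> coeff_hd f n = 0) \<Longrightarrow> f \<in> dirichlet_polynomials"
  unfolding dirichlet_polynomials_def by blast

lemma eval_hd_finite:
  assumes "\<forall>n\<ge>N. coeff_hd f n = 0"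
  shows "eval_hd f s = (\<Sum>n<N. coeff_hd f n * of_nat n powr (- s))"
  unfolding eval_hd_def dirichlet_series_def by (rule suminf_finite) (use assms in auto)

lemma zero_dirichlet_polynomials: "0 \<in> dirichlet_polynomials"
  by (auto simp: dirichlet_polynomials_def)

lemma eval_hd_zero: "eval_hd 0 s = 0"
  by (simp add: eval_hd_def dirichlet_series_def)

lemma monomial_dirichlet_polynomials: "monomial_hd z n \<in> dirichlet_polynomials"
  by (rule dirichlet_polynomialsI[of "Suc n"]) auto

lemma eval_monomial_hd: "eval_hd (monomial_hd z n) s = z * of_nat n powr (- s)"
proof -
  have "eval_hd (monomial_hd z n) s
      = (\<Sum>m<Suc n. coeff_hd (monomial_hd z n) m * of_nat m powr (- s))"
    by (rule eval_hd_finite) auto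
  also have "\<dots> = z * of_nat n powr (- s)"
    by (simp add: sum.neutral)
  finally show ?thesis .
qed

lemma common_support:
  assumes "f \<in> dirichlet_polynomials" "g \<in> dirichlet_polynomials"
  obtains N where "\<forall>n\<ge>N. coeff_hd f n = 0" "\<forall>n\<ge>N. coeff_hd g n = 0"
proof -
  obtain N M where "\<forall>n\<ge>N. coeff_hd f n = 0" "\<forall>n\<ge>M. coeff_hd g n = 0"
    using assms by (auto simp: dirichlet_polynomials_def)
  then show ?thesis by (intro that[of "max N M"]) auto
qed

lemma add_dirichlet_polynomials:
  assumes "f \<in> dirichlet_polynomials" "g \<in> dirichlet_polynomials"
  shows "f + g \<in> dirichlet_polynomials \<and> eval_hd (f + g) s = eval_hd f s + eval_hd g s"
proof -
  obtain N where N: "\<forall>n\<ge>N. coeff_hd f n = 0" "\<forall>n\<ge>N. coeff_hd g n = 0"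
    using common_support[OF assms] .
  then have fg: "\<forall>n\<ge>N. coeff_hd (f + g) n = 0" by simp
  then show ?thesis
    unfolding eval_hd_finite[OF N(1)] eval_hd_finite[OF N(2)] eval_hd_finite[OF fg]
    by (auto intro!: dirichlet_polynomialsI[of N] simp: algebra_simps sum.distrib)
qed

lemma diff_dirichlet_polynomials:
  assumes "f \<in> dirichlet_polynomials" "g \<in> dirichlet_polynomials"
  shows "f - g \<in> dirichlet_polynomials \<and> eval_hd (f - g) s = eval_hd f s - eval_hd g s"
proof -
  obtain N where N: "\<forall>n\<ge>N. coeff_hd f n = 0" "\<forall>n\<ge>N. coeff_hd g n = 0"
    using common_support[OF assms] .
  then have fg: "\<forall>n\<ge>N. coeff_hd (f - g) n = 0" by simp
  then show ?thesis
    unfolding eval_hd_finite[OF N(1)] eval_hd_finite[OF N(2)] eval_hd_finite[OF fg]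
    by (auto intro!: dirichlet_polynomialsI[of N] simp: algebra_simps sum_subtractf)
qed

lemma sum_dirichlet_polynomials:
  assumes "\<And>i. i \<in> A \<Longrightarrow> F i \<in> dirichlet_polynomials"
  shows "sum F A \<in> dirichlet_polynomials \<and> eval_hd (sum F A) s = (\<Sum>i\<in>A. eval_hd (F i) s)"
  using assms
proof (induction A rule: infinite_finite_induct)
  case (insert i A)
  then show ?case using add_dirichlet_polynomials[of "F i" "sum F A" s] by auto
qed (simp_all add: zero_dirichlet_polynomials eval_hd_zero)

lemma of_nat_powr_mult: "(of_nat (n * k) :: complex) powr z = of_nat n powr z * of_nat k powr z"
  by (simp add: powr_times_real_left)

text \<open>The product of two monomials is a monomial, because \<open>n powr - s\<close> is multiplicative in
  \<open>n\<close>. Convolution of coefficients is avoided by summing these products in \<open>\<H>\<close>.\<close>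

lemma mult_dirichlet_polynomials:
  assumes "f \<in> dirichlet_polynomials" "g \<in> dirichlet_polynomials"
  shows "\<exists>h\<in>dirichlet_polynomials. \<forall>s. eval_hd h s = eval_hd f s * eval_hd g s"
proof -
  obtain N where N: "\<forall>n\<ge>N. coeff_hd f n = 0" "\<forall>n\<ge>N. coeff_hd g n = 0"
    using common_support[OF assms] .
  define h where "h = (\<Sum>n<N. \<Sum>k<N. monomial_hd (coeff_hd f n * coeff_hd g k) (n * k))"
  have "h \<in> dirichlet_polynomials \<and> eval_hd h s = (\<Sum>n<N. \<Sum>k<N. eval_hd (monomial_hd (coeff_hd f n * coeff_hd g k) (n * k)) s)" for s
    unfolding h_def
    by (simp add: sum_dirichlet_polynomials monomial_dirichlet_polynomials)
  moreover have "(\<Sum>n<N. \<Sum>k<N. eval_hd (monomial_hd (coeff_hd f n * coeff_hd g k) (n * k)) s)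
      = eval_hd f s * eval_hd g s" for s
    unfolding eval_hd_finite[OF N(1)] eval_hd_finite[OF N(2)] sum_product eval_monomial_hd of_nat_powr_mult
    by (simp add: mult_ac)
  ultimately show ?thesis by auto
qed

lemma bounded_dirichlet_polynomials:
  assumes "f \<in> dirichlet_polynomials"
  shows "\<exists>B. \<forall>s\<in>half_plane 0. cmod (eval_hd f s) \<le> B"
proof -
  obtain N where N: "\<forall>n\<ge>N. coeff_hd f n = 0"
    using assms by (auto simp: dirichlet_polynomials_def)
  have "cmod (eval_hd f s) \<le> (\<Sum>n<N. cmod (coeff_hd f n))" if "s \<in> half_plane 0" for s
    unfolding eval_hd_finite[OF N]
  proof (rule sum_norm_le)
    fix n
    have "real n powr - Re s \<le> 1"
      using powr_minus_abs_le_1[of n "Re s"] that by (simp add: half_plane_def)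
    then show "cmod (coeff_hd f n * of_nat n powr (- s)) \<le> cmod (coeff_hd f n)"
      by (simp add: norm_mult norm_of_nat_powr mult_left_le)
  qed
  then show ?thesis by blast
qed

section \<open>The Hardy norm is at most the supremum norm\<close>

lemma unimodular_mean_tendsto:
  fixes z :: complex
  assumes "cmod z = 1"
  shows "(\<lambda>M. (\<Sum>m<M. z ^ m) / of_nat M) \<longlonglongrightarrow> (if z = 1 then 1 else 0)"
proof (cases "z = 1")
  case True
  have "\<forall>\<^sub>F M in sequentially. (\<Sum>m<M. z ^ m) / of_nat M = 1"
    using eventually_gt_at_top[of 0] by eventually_elim (simp add: True)
  then show ?thesis by (simp add: True tendsto_eventually)
next
  case False
  have "(\<lambda>M. (\<Sum>m<M. z ^ m) / of_nat M) \<longlonglongrightarrow> 0"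
  proof (rule Lim_null_comparison)
    show "\<forall>\<^sub>F M in sequentially. norm ((\<Sum>m<M. z ^ m) / of_nat M) \<le> (2 / cmod (z - 1)) * (1 / real M)"
    proof (rule always_eventually, rule allI)
      fix M
      have "cmod (z ^ M - 1) \<le> 2"
        using norm_triangle_ineq4[of "z ^ M" 1] assms by (simp add: norm_power)
      then have "cmod (\<Sum>m<M. z ^ m) \<le> 2 / cmod (z - 1)"
        using False by (simp add: geometric_sum norm_divide divide_right_mono)
      then show "norm ((\<Sum>m<M. z ^ m) / of_nat M) \<le> (2 / cmod (z - 1)) * (1 / real M)"
        using divide_right_mono[of _ _ "real M"] by (fastforce simp: norm_divide)
    qed
    show "(\<lambda>M. (2 / cmod (z - 1)) * (1 / real M)) \<longlonglongrightarrow> 0"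
      by (intro tendsto_mult_right_zero lim_1_over_n)
  qed
  then show ?thesis using False by simp
qed

text \<open>Characters of the natural numbers with distinct values at 1 are orthogonal in the mean:
  expanding the square, the mean of \<open>(u n * cnj (u k)) ^ m\<close> tends to 1 on the diagonal and to 0
  off it.\<close>

lemma mean_square_tendsto:
  fixes b u :: "'a \<Rightarrow> complex"
  assumes "finite I" "inj_on u I" "\<And>n. n \<in> I \<Longrightarrow> cmod (u n) = 1"
  shows "(\<lambda>M. (\<Sum>m<M. (cmod (\<Sum>n\<in>I. b n * u n ^ m))\<^sup>2) / real M) \<longlonglongrightarrow> (\<Sum>n\<in>I. (cmod (b n))\<^sup>2)"
proof -
  have ortho: "u n * cnj (u k) = 1 \<longleftrightarrow> n = k" if "n \<in> I" "k \<in> I" for n k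
  proof
    assume "u n * cnj (u k) = 1"
    then have "u n * (cnj (u k) * u k) = u k" by (metis mult.assoc mult.left_neutral)
    moreover have "cnj (u k) * u k = 1"
      using assms(3)[OF that(2)] by (metis complex_norm_square mult.commute of_real_1 one_power2)
    ultimately show "n = k" using assms(2) that by (simp add: inj_on_def)
  next
    assume "n = k"
    then show "u n * cnj (u k) = 1"
      using assms(3)[OF that(2)] by (metis complex_norm_square of_real_1 one_power2)
  qed
  have eq: "complex_of_real ((\<Sum>m<M. (cmod (\<Sum>n\<in>I. b n * u n ^ m))\<^sup>2) / real M)
      = (\<Sum>n\<in>I. \<Sum>k\<in>I. b n * cnj (b k) * ((\<Sum>m<M. (u n * cnj (u k)) ^ m) / of_nat M))" for M
  proof -
    have "complex_of_real (\<Sum>m<M. (cmod (\<Sum>n\<in>I. b n * u n ^ m))\<^sup>2)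
        = (\<Sum>m<M. \<Sum>n\<in>I. \<Sum>k\<in>I. b n * cnj (b k) * (u n * cnj (u k)) ^ m)"
      by (simp add: complex_norm_square sum_product power_mult_distrib mult_ac del: of_real_power)
    also have "\<dots> = (\<Sum>n\<in>I. \<Sum>m<M. \<Sum>k\<in>I. b n * cnj (b k) * (u n * cnj (u k)) ^ m)"
      by (rule sum.swap)
    also have "\<dots> = (\<Sum>n\<in>I. \<Sum>k\<in>I. \<Sum>m<M. b n * cnj (b k) * (u n * cnj (u k)) ^ m)"
      by (intro sum.cong refl sum.swap)
    finally have sq: "complex_of_real (\<Sum>m<M. (cmod (\<Sum>n\<in>I. b n * u n ^ m))\<^sup>2)
        = (\<Sum>n\<in>I. \<Sum>k\<in>I. \<Sum>m<M. b n * cnj (b k) * (u n * cnj (u k)) ^ m)" .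
    show ?thesis
      unfolding of_real_divide of_real_of_nat_eq sq
      by (simp only: sum_divide_distrib sum_distrib_left times_divide_eq_right)
  qed
  have "(\<lambda>M. complex_of_real ((\<Sum>m<M. (cmod (\<Sum>n\<in>I. b n * u n ^ m))\<^sup>2) / real M))
      \<longlonglongrightarrow> (\<Sum>n\<in>I. \<Sum>k\<in>I. b n * cnj (b k) * (if u n * cnj (u k) = 1 then 1 else 0))"
    unfolding eq
    by (intro tendsto_sum tendsto_mult tendsto_const unimodular_mean_tendsto)
      (simp add: norm_mult assms(3))
  also have "(\<Sum>n\<in>I. \<Sum>k\<in>I. b n * cnj (b k) * (if u n * cnj (u k) = 1 then 1 else 0))
      = (\<Sum>n\<in>I. \<Sum>k\<in>I. if n = k then complex_of_real ((cmod (b n))\<^sup>2) else 0)"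
    by (intro sum.cong refl) (simp add: ortho complex_norm_square del: of_real_power)
  also have "\<dots> = complex_of_real (\<Sum>n\<in>I. (cmod (b n))\<^sup>2)"
    using assms(1) by simp
  finally show ?thesis unfolding tendsto_of_real_iff .
qed

text \<open>Carlson's mean value theorem for polynomials. Sampling the imaginary axis in steps of
  \<open>1 / N\<close> replaces the integral means: for \<open>n < N\<close> the angles \<open>ln n / N\<close> lie in
  an interval shorter than a full turn, so the sampled characters are still distinct.\<close>

lemma norm_le_sup_imaginary_axis:
  assumes f: "f \<in> dirichlet_polynomials" and B: "\<And>s. Re s = 0 \<Longrightarrow> cmod (eval_hd f s) \<le> B"
  shows "norm f \<le> B"
proof -
  obtain N where N: "\<forall>n\<ge>N. coeff_hd f n = 0"
    using f by (auto simp: dirichlet_polynomials_def)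
  have "0 \<le> cmod (eval_hd f 0)" by (rule norm_ge_zero)
  also have "\<dots> \<le> B" by (rule B) simp
  finally have "B \<ge> 0" .
  define u where "u n = exp (\<i> * of_real (- ln (real n) / real N))" for n
  define I where "I = {1..<N}"
  have u1: "cmod (u n) = 1" for n
    unfolding u_def by simp
  have "inj_on u I"
  proof (rule inj_onI)
    fix n k assume nk: "n \<in> I" "k \<in> I" "u n = u k"
    have small: "0 \<le> ln (real n) / real N" "ln (real n) / real N \<le> 1" if "n \<in> I" for n
      using that ln_le_minus_one[of "real n"] by (auto simp: I_def divide_le_eq)
    have "\<bar>ln (real k) / real N - ln (real n) / real N\<bar> \<le> 1"
      using small[OF nk(1)] small[OF nk(2)] by linarith
    also have "1 < 2 * pi" using pi_gt3 by simp
    finally have "\<bar>Im (\<i> * of_real (- ln (real n) / real N)) - Im (\<i> * of_real (- ln (real k) / real N))\<bar> < 2 * pi"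
      by (simp only: Im_i_times Re_complex_of_real minus_divide_left[symmetric] minus_diff_minus
          abs_minus_cancel abs_minus_commute)
    then have "\<i> * of_real (- ln (real n) / real N) = \<i> * of_real (- ln (real k) / real N)"
      by (rule exp_complex_eqI) (use nk(3) in \<open>simp only: u_def\<close>)
    then have "Im (\<i> * of_real (- ln (real n) / real N)) = Im (\<i> * of_real (- ln (real k) / real N))"
      by (rule arg_cong)
    then have "- ln (real n) / real N = - ln (real k) / real N"
      by (simp only: Im_i_times Re_complex_of_real)
    then show "n = k" using nk(1,2) by (simp add: I_def)
  qed
  have ev: "eval_hd f (\<i> * of_real (real m / real N)) = (\<Sum>n\<in>I. coeff_hd f n * u n ^ m)" for m
  proof -
    have "eval_hd f (\<i> * of_real (real m / real N))
        = (\<Sum>n<N. coeff_hd f n * of_nat n powr (- (\<i> * of_real (real m / real N))))"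
      by (rule eval_hd_finite[OF N])
    also have "\<dots> = (\<Sum>n\<in>I. coeff_hd f n * of_nat n powr (- (\<i> * of_real (real m / real N))))"
      by (rule sum.mono_neutral_right) (auto simp: I_def not_le)
    also have "\<dots> = (\<Sum>n\<in>I. coeff_hd f n * u n ^ m)"
      by (intro sum.cong refl)
        (auto simp: I_def u_def powr_def Ln_of_nat field_simps simp flip: exp_of_nat_mult)
    finally show ?thesis .
  qed
  have "(\<Sum>n\<in>I. (cmod (coeff_hd f n))\<^sup>2) \<le> B\<^sup>2"
  proof (rule LIMSEQ_le_const2[OF mean_square_tendsto[of I u "coeff_hd f"]])
    have "(\<Sum>m<M. (cmod (\<Sum>n\<in>I. coeff_hd f n * u n ^ m))\<^sup>2) / real M \<le> B\<^sup>2" if "M \<ge> 1" for M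
    proof -
      have "(\<Sum>m<M. (cmod (\<Sum>n\<in>I. coeff_hd f n * u n ^ m))\<^sup>2) \<le> (\<Sum>m<M. B\<^sup>2)"
        unfolding ev[symmetric] by (intro sum_mono power_mono B) auto
      with that show ?thesis by (simp add: divide_le_eq mult.commute)
    qed
    then show "\<exists>M. \<forall>m\<ge>M. (\<Sum>m<m. (cmod (\<Sum>n\<in>I. coeff_hd f n * u n ^ m))\<^sup>2) / real m \<le> B\<^sup>2"
      by blast
  qed (use \<open>inj_on u I\<close> u1 in \<open>auto simp: I_def\<close>)
  also have "(\<Sum>n\<in>I. (cmod (coeff_hd f n))\<^sup>2) = (norm f)\<^sup>2"
  proof -
    have "(norm f)\<^sup>2 = (\<Sum>n\<in>I. (cmod (coeff_hd f n))\<^sup>2)"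
      unfolding norm_hd_square
    proof (rule suminf_finite)
      fix n assume "n \<notin> I"
      then have "n = 0 \<or> n \<ge> N" by (auto simp: I_def)
      then show "(cmod (coeff_hd f n))\<^sup>2 = 0" using N by auto
    qed (simp add: I_def)
    then show ?thesis by simp
  qed
  finally show ?thesis using \<open>B \<ge> 0\<close> by (rule power2_le_imp_le)
qed

text \<open>The imaginary axis is reached from the right: apply the previous bound to the translates by
  \<open>t > 0\<close> and let \<open>t\<close> tend to 0.\<close>

lemma norm_le_sup_half_plane:
  assumes f: "f \<in> dirichlet_polynomials"
    and B: "\<And>s. s \<in> half_plane 0 \<Longrightarrow> cmod (eval_hd f s) \<le> B"
  shows "norm f \<le> B"
proof -
  have "norm (translate_hd t f) \<le> B" if "t > 0" for t
  proof (rule norm_le_sup_imaginary_axis)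
    show "translate_hd t f \<in> dirichlet_polynomials"
      using f by (auto simp: dirichlet_polynomials_def)
    show "cmod (eval_hd (translate_hd t f) s) \<le> B" if "Re s = 0" for s
      using that \<open>t > 0\<close> by (simp add: eval_translate_hd B half_plane_def)
  qed
  then have "\<forall>\<^sub>F t in at_right 0. norm (translate_hd t f) \<le> B"
    by (auto simp: eventually_at_right_less eventually_at_filter)
  moreover have "((\<lambda>t. norm (translate_hd t f)) \<longlongrightarrow> norm (translate_hd 0 f)) (at_right 0)"
    using continuous_on_translate_hd[of f]
    by (intro tendsto_norm) (metis UNIV_I continuous_on_eq_continuous_at continuous_at filterlim_at_split open_UNIV)
  ultimately show ?thesis
    using tendsto_upperbound trivial_limit_at_right_real by (metis translate_hd_0)
qed

section \<open>Uniqueness of Dirichlet series\<close>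

text \<open>If the difference \<open>h\<close> vanishes on the half-plane, its truncations, translated by one unit, tend to 0 uniformly
  on the right half-plane. Being polynomials, they then tend to 0 in norm, hence coefficientwise.\<close>

lemma eval_hd_determines:
  assumes "\<And>s. s \<in> half_plane (1/2) \<Longrightarrow> eval_hd f s = eval_hd g s"
  shows "f = g"
proof -
  define h where "h = f - g"
  define E where "E = sqrt (\<Sum>n. real n powr (-2 * 1))"
  have h0: "eval_hd h s = 0" if "Re s > 1/2" for s
    using that assms[of s] linear_diff[OF bounded_linear.linear[OF bounded_linear_eval_hd[OF that]]]
    by (simp add: h_def half_plane_def)
  \<comment> \<open>One unit to the right the truncations of \<open>h\<close> tend to \<open>h = 0\<close> uniformly.\<close>
  have trunc: "norm (translate_hd 1 (truncate_hd N h)) \<le> norm (truncate_hd N h - h) * E" for N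
  proof (rule norm_le_sup_half_plane)
    show "translate_hd 1 (truncate_hd N h) \<in> dirichlet_polynomials"
      by (rule dirichlet_polynomialsI[of N]) auto
    fix s assume "s \<in> half_plane 0"
    then have s: "Re (s + 1) \<ge> 1" "Re (s + 1) > 1/2" by (auto simp: half_plane_def)
    have "eval_hd (translate_hd 1 (truncate_hd N h)) s = eval_hd (truncate_hd N h) (s + 1)"
      using eval_translate_hd[of 1] by simp
    also have "\<dots> = eval_hd (truncate_hd N h - h) (s + 1)"
      using linear_diff[OF bounded_linear.linear[OF bounded_linear_eval_hd[OF s(2)]]] h0[OF s(2)]
      by simp
    finally show "cmod (eval_hd (translate_hd 1 (truncate_hd N h)) s) \<le> norm (truncate_hd N h - h) * E"
      using norm_eval_hd_le[OF s(1), of "truncate_hd N h - h"] by (simp add: E_def)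
  qed
  have lim: "(\<lambda>N. norm (truncate_hd N h - h) * E) \<longlonglongrightarrow> 0"
    using tendsto_mult_left_zero[OF tendsto_norm_zero[OF LIM_zero[OF truncate_hd_tendsto[of h]]]] .
  have "coeff_hd h n = 0" for n
  proof (cases "n = 0")
    case False
    have "cmod (coeff_hd (translate_hd 1 h) n) \<le> 0"
    proof (rule LIMSEQ_le_const[OF lim])
      have "cmod (coeff_hd (translate_hd 1 h) n) \<le> norm (truncate_hd N h - h) * E" if "N \<ge> Suc n" for N
      proof -
        have "coeff_hd (translate_hd 1 h) n = coeff_hd (translate_hd 1 (truncate_hd N h)) n"
          using that by simp
        also have "cmod \<dots> \<le> norm (translate_hd 1 (truncate_hd N h))"
          by (rule coeff_hd_le_norm)
        also note trunc[of N]
        finally show ?thesis .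
      qed
      then show "\<exists>M. \<forall>N\<ge>M. cmod (coeff_hd (translate_hd 1 h) n) \<le> norm (truncate_hd N h - h) * E"
        by blast
    qed
    then have "coeff_hd (translate_hd 1 h) n = 0" by (simp only: norm_le_zero_iff)
    with False show ?thesis by simp
  qed simp
  then have "coeff_hd f n = coeff_hd g n" for n
    by (simp add: h_def)
  then show ?thesis by (rule hd_eqI)
qed

lemma composition_operator_unique:
  assumes "is_composition_operator \<phi> T" "is_composition_operator \<phi>' T'"
    and "\<And>s. s \<in> half_plane (1/2) \<Longrightarrow> \<phi> s = \<phi>' s"
  shows "T = T'"
proof (rule blinfun_eqI)
  fix f show "blinfun_apply T f = blinfun_apply T' f"
    using assms by (intro eval_hd_determines) (auto simp: is_composition_operator_def)
qed

section \<open>Uniform limits of Dirichlet polynomials\<close>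

text \<open>The uniform closure of the Dirichlet polynomials on the right half-plane, an algebra of bounded
  functions. It is closed under the exponential function, and that is how the powers
  \<open>n powr - \<phi> s\<close> of a symbol are recognised as members without handling their coefficients.\<close>

definition uniform_dirichlet :: "(complex \<Rightarrow> complex) \<Rightarrow> bool" where
  "uniform_dirichlet F \<longleftrightarrow>
     (\<forall>e>0. \<exists>p\<in>dirichlet_polynomials. \<forall>s\<in>half_plane 0. cmod (F s - eval_hd p s) < e)"

lemma uniform_dirichlet_polynomial: "p \<in> dirichlet_polynomials \<Longrightarrow> uniform_dirichlet (eval_hd p)"
  unfolding uniform_dirichlet_def by (auto intro!: bexI[of _ p])

lemma uniform_dirichlet_monomial: "uniform_dirichlet (\<lambda>s. z * of_nat n powr - s)"
  using uniform_dirichlet_polynomial[OF monomial_dirichlet_polynomials, of z n]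
  by (simp add: eval_monomial_hd[abs_def])

lemma uniform_dirichlet_const: "uniform_dirichlet (\<lambda>s. z)"
  using uniform_dirichlet_monomial[of z 1] by simp

lemma uniform_dirichlet_limit:
  assumes "\<And>e. e > 0 \<Longrightarrow> \<exists>G. uniform_dirichlet G \<and> (\<forall>s\<in>half_plane 0. cmod (F s - G s) < e)"
  shows "uniform_dirichlet F"
  unfolding uniform_dirichlet_def
proof (intro allI impI)
  fix e :: real assume "e > 0"
  then obtain G where G: "uniform_dirichlet G" "\<forall>s\<in>half_plane 0. cmod (F s - G s) < e / 2"
    using assms[of "e / 2"] by auto
  obtain p where p: "p \<in> dirichlet_polynomials" "\<forall>s\<in>half_plane 0. cmod (G s - eval_hd p s) < e / 2"
    using G(1) \<open>e > 0\<close> unfolding uniform_dirichlet_def by (metis half_gt_zero)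
  have "cmod (F s - eval_hd p s) < e" if "s \<in> half_plane 0" for s
    using norm_diff_triangle_less[of "F s" "G s" "e / 2" "eval_hd p s" "e / 2"] G(2) p(2) that
    by simp
  with p(1) show "\<exists>p\<in>dirichlet_polynomials. \<forall>s\<in>half_plane 0. cmod (F s - eval_hd p s) < e"
    by blast
qed

lemma uniform_dirichlet_bounded:
  assumes "uniform_dirichlet F"
  obtains R where "R > 0" "\<And>s. s \<in> half_plane 0 \<Longrightarrow> cmod (F s) \<le> R"
proof -
  obtain p where p: "p \<in> dirichlet_polynomials" "\<forall>s\<in>half_plane 0. cmod (F s - eval_hd p s) < 1"
    using assms unfolding uniform_dirichlet_def by (metis zero_less_one)
  obtain B where B: "\<forall>s\<in>half_plane 0. cmod (eval_hd p s) \<le> B"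
    using bounded_dirichlet_polynomials[OF p(1)] by blast
  have "cmod (F s) \<le> \<bar>B\<bar> + 1" if "s \<in> half_plane 0" for s
    using norm_triangle_sub[of "F s" "eval_hd p s"] p(2) B that by fastforce
  then show ?thesis by (intro that[of "\<bar>B\<bar> + 1"]) auto
qed

lemma uniform_dirichlet_add:
  assumes "uniform_dirichlet F" "uniform_dirichlet G"
  shows "uniform_dirichlet (\<lambda>s. F s + G s)"
  unfolding uniform_dirichlet_def
proof (intro allI impI)
  fix e :: real assume "e > 0"
  then have "e / 2 > 0" by simp
  then obtain p q where
    p: "p \<in> dirichlet_polynomials" "\<forall>s\<in>half_plane 0. cmod (F s - eval_hd p s) < e / 2" and
    q: "q \<in> dirichlet_polynomials" "\<forall>s\<in>half_plane 0. cmod (G s - eval_hd q s) < e / 2"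
    using assms unfolding uniform_dirichlet_def by meson
  have "cmod (F s + G s - eval_hd (p + q) s) < e" if "s \<in> half_plane 0" for s
  proof -
    have "F s + G s - eval_hd (p + q) s = (F s - eval_hd p s) + (G s - eval_hd q s)"
      using add_dirichlet_polynomials[OF p(1) q(1), of s] by simp
    also have "cmod \<dots> < e / 2 + e / 2"
      using p(2) q(2) that by (intro norm_add_less) auto
    finally show ?thesis by simp
  qed
  then show "\<exists>p\<in>dirichlet_polynomials. \<forall>s\<in>half_plane 0. cmod (F s + G s - eval_hd p s) < e"
    using add_dirichlet_polynomials[OF p(1) q(1)] by blast
qed

lemma uniform_dirichlet_mult:
  assumes "uniform_dirichlet F" "uniform_dirichlet G"
  shows "uniform_dirichlet (\<lambda>s. F s * G s)"
  unfolding uniform_dirichlet_def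
proof (intro allI impI)
  fix e :: real assume "e > 0"
  obtain R where R: "R > 0" "\<And>s. s \<in> half_plane 0 \<Longrightarrow> cmod (F s) \<le> R"
    using uniform_dirichlet_bounded[OF assms(1)] by blast
  have "e / (2 * R) > 0" using \<open>e > 0\<close> R by simp
  then obtain q where q: "q \<in> dirichlet_polynomials" "\<forall>s\<in>half_plane 0. cmod (G s - eval_hd q s) < e / (2 * R)"
    using assms(2) unfolding uniform_dirichlet_def by blast
  obtain Q where Q: "Q > 0" "\<And>s. s \<in> half_plane 0 \<Longrightarrow> cmod (eval_hd q s) \<le> Q"
    using uniform_dirichlet_bounded[OF uniform_dirichlet_polynomial[OF q(1)]] by blast
  have "e / (2 * Q) > 0" using \<open>e > 0\<close> Q by simp
  then obtain p where p: "p \<in> dirichlet_polynomials" "\<forall>s\<in>half_plane 0. cmod (F s - eval_hd p s) < e / (2 * Q)"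
    using assms(1) unfolding uniform_dirichlet_def by blast
  obtain h where h: "h \<in> dirichlet_polynomials" "\<And>s. eval_hd h s = eval_hd p s * eval_hd q s"
    using mult_dirichlet_polynomials[OF p(1) q(1)] by blast
  have "cmod (F s * G s - eval_hd h s) < e" if s: "s \<in> half_plane 0" for s
  proof -
    have "F s * G s - eval_hd h s = F s * (G s - eval_hd q s) + (F s - eval_hd p s) * eval_hd q s"
      by (simp add: h algebra_simps)
    also have "cmod \<dots> \<le> cmod (F s) * cmod (G s - eval_hd q s) + cmod (F s - eval_hd p s) * cmod (eval_hd q s)"
      by (metis norm_mult norm_triangle_ineq)
    \<comment> \<open>The bound \<open>Q\<close> belongs to the polynomial \<open>q\<close>, which is why \<open>q\<close> is chosen before \<open>p\<close>.\<close>
    also have "\<dots> \<le> R * cmod (G s - eval_hd q s) + cmod (F s - eval_hd p s) * Q"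
      using R Q s by (intro add_mono mult_mono) auto
    also have "\<dots> < R * (e / (2 * R)) + (e / (2 * Q)) * Q"
      using R(1) Q(1) p(2) q(2) s
      by (intro add_strict_mono mult_strict_left_mono mult_strict_right_mono) auto
    also have "\<dots> = e" using R(1) Q(1) by simp
    finally show ?thesis .
  qed
  then show "\<exists>p\<in>dirichlet_polynomials. \<forall>s\<in>half_plane 0. cmod (F s * G s - eval_hd p s) < e"
    using h(1) by blast
qed

lemma uniform_dirichlet_sum:
  assumes "\<And>i. i \<in> A \<Longrightarrow> uniform_dirichlet (F i)"
  shows "uniform_dirichlet (\<lambda>s. \<Sum>i\<in>A. F i s)"
  using assms
  by (induction A rule: infinite_finite_induct)
    (simp_all add: uniform_dirichlet_const uniform_dirichlet_add)

lemma uniform_dirichlet_power: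
  "uniform_dirichlet F \<Longrightarrow> uniform_dirichlet (\<lambda>s. F s ^ k)"
  by (induction k) (simp_all add: uniform_dirichlet_const uniform_dirichlet_mult)

lemma uniform_dirichlet_exp:
  assumes "uniform_dirichlet F"
  shows "uniform_dirichlet (\<lambda>s. exp (F s))"
proof (rule uniform_dirichlet_limit)
  fix e :: real assume "e > 0"
  obtain R where R: "R > 0" "\<And>s. s \<in> half_plane 0 \<Longrightarrow> cmod (F s) \<le> R"
    using uniform_dirichlet_bounded[OF assms] by blast
  have "uniform_limit (half_plane 0) (\<lambda>n s. \<Sum>i<n. F s ^ i /\<^sub>R fact i) (\<lambda>s. \<Sum>i. F s ^ i /\<^sub>R fact i) sequentially"
  proof (rule Weierstrass_m_test)
    show "summable (\<lambda>i. R ^ i /\<^sub>R fact i)" by (rule summable_exp_generic)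
    show "norm (F s ^ n /\<^sub>R fact n) \<le> R ^ n /\<^sub>R fact n" if "s \<in> half_plane 0" for n s
      using R(2)[OF that] by (simp add: norm_power power_mono mult_left_mono)
  qed
  from uniform_limitD[OF this \<open>e > 0\<close>] obtain n where
    "\<forall>s\<in>half_plane 0. dist (\<Sum>i<n. F s ^ i /\<^sub>R fact i) (\<Sum>i. F s ^ i /\<^sub>R fact i) < e"
    by (auto simp: eventually_sequentially)
  then have n: "\<forall>s\<in>half_plane 0. cmod (exp (F s) - (\<Sum>i<n. F s ^ i /\<^sub>R fact i)) < e"
    by (simp add: exp_def dist_norm norm_minus_commute)
  have "uniform_dirichlet (\<lambda>s. \<Sum>i<n. F s ^ i /\<^sub>R fact i)"
    unfolding scaleR_conv_of_real
    by (intro uniform_dirichlet_sum uniform_dirichlet_mult uniform_dirichlet_const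
        uniform_dirichlet_power assms)
  with n show "\<exists>G. uniform_dirichlet G \<and> (\<forall>s\<in>half_plane 0. cmod (exp (F s) - G s) < e)"
    by blast
qed

text \<open>Approximating polynomials form a Cauchy sequence in \<open>\<H>\<close>, by the inequality between the norms,
  and its limit represents \<open>F\<close> because point evaluations are continuous.\<close>

lemma uniform_dirichlet_in_hd:
  assumes F: "uniform_dirichlet F" and B: "\<And>s. s \<in> half_plane 0 \<Longrightarrow> cmod (F s) \<le> B"
  shows "\<exists>f. (\<forall>s\<in>half_plane (1/2). eval_hd f s = F s) \<and> norm f \<le> B"
proof -
  have "\<forall>k. \<exists>p\<in>dirichlet_polynomials. \<forall>s\<in>half_plane 0. cmod (F s - eval_hd p s) < inverse (of_nat (Suc k))"
    using F unfolding uniform_dirichlet_def by simp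
  then obtain p where p: "\<And>k. p k \<in> dirichlet_polynomials"
    "\<And>k s. s \<in> half_plane 0 \<Longrightarrow> cmod (F s - eval_hd (p k) s) < inverse (of_nat (Suc k))"
    by metis
  have pd: "norm (p k - p l) \<le> inverse (of_nat (Suc k)) + inverse (of_nat (Suc l))" for k l
  proof (rule norm_le_sup_half_plane)
    note d = diff_dirichlet_polynomials[OF p(1)[of k] p(1)[of l]]
    show "p k - p l \<in> dirichlet_polynomials" using d by blast
    fix s assume s: "s \<in> half_plane 0"
    have "eval_hd (p k - p l) s = (F s - eval_hd (p l) s) - (F s - eval_hd (p k) s)"
      using d[of s] by simp
    then show "cmod (eval_hd (p k - p l) s) \<le> inverse (of_nat (Suc k)) + inverse (of_nat (Suc l))"
      using norm_triangle_ineq4[of "F s - eval_hd (p l) s" "F s - eval_hd (p k) s"] p(2)[OF s, of k] p(2)[OF s, of l]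
      by simp
  qed
  have "Cauchy p"
  proof (rule metric_CauchyI)
    fix e :: real assume "e > 0"
    then obtain K where K: "inverse (of_nat (Suc K)) < e / 2"
      using reals_Archimedean[of "e / 2"] by auto
    have "dist (p k) (p l) < e" if "k \<ge> K" "l \<ge> K" for k l
    proof -
      have "inverse (real (Suc k)) \<le> inverse (real (Suc K))" "inverse (real (Suc l)) \<le> inverse (real (Suc K))"
        using that by (auto intro!: le_imp_inverse_le)
      then show ?thesis using pd[of k l] K unfolding dist_norm by linarith
    qed
    then show "\<exists>M. \<forall>m\<ge>M. \<forall>n\<ge>M. dist (p m) (p n) < e" by blast
  qed
  then obtain f where f: "p \<longlonglongrightarrow> f"
    by (auto simp: Cauchy_convergent_iff convergent_def)
  have "eval_hd f s = F s" if s: "s \<in> half_plane (1/2)" for s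
  proof (rule LIMSEQ_unique)
    show "(\<lambda>k. eval_hd (p k) s) \<longlonglongrightarrow> eval_hd f s"
      using s by (intro bounded_linear.tendsto[OF bounded_linear_eval_hd] f) (auto simp: half_plane_def)
    show "(\<lambda>k. eval_hd (p k) s) \<longlonglongrightarrow> F s"
    proof (rule LIM_zero_cancel, rule Lim_null_comparison[OF _ LIMSEQ_inverse_real_of_nat])
      have "s \<in> half_plane 0" using s by (simp add: half_plane_def)
      then have "norm (eval_hd (p k) s - F s) \<le> inverse (real (Suc k))" for k
        using p(2)[of s k] by (simp add: norm_minus_commute)
      then show "\<forall>\<^sub>F k in sequentially. norm (eval_hd (p k) s - F s) \<le> inverse (real (Suc k))"
        by simp
    qed
  qed
  moreover have "norm f \<le> B"
  proof (rule LIMSEQ_le)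
    show "(\<lambda>k. norm (p k)) \<longlonglongrightarrow> norm f"
      by (intro tendsto_norm f)
    show "(\<lambda>k. B + inverse (real (Suc k))) \<longlonglongrightarrow> B"
      using tendsto_add[OF tendsto_const LIMSEQ_inverse_real_of_nat, of B] by simp
    have "norm (p k) \<le> B + inverse (real (Suc k))" for k
    proof (rule norm_le_sup_half_plane[OF p(1)])
      fix s assume s: "s \<in> half_plane 0"
      show "cmod (eval_hd (p k) s) \<le> B + inverse (real (Suc k))"
        using norm_triangle_ineq4[of "F s" "F s - eval_hd (p k) s"] B[OF s] p(2)[OF s, of k]
        by simp
    qed
    then show "\<exists>K. \<forall>k\<ge>K. norm (p k) \<le> B + inverse (real (Suc k))" by blast
  qed
  ultimately show ?thesis by blast
qed

text \<open>Elements given by other means, such as differences, obey the bound too: by uniqueness they are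
  the limit just constructed.\<close>

lemma norm_le_sup_uniform_dirichlet:
  assumes F: "uniform_dirichlet F"
    and f: "\<And>s. s \<in> half_plane (1/2) \<Longrightarrow> eval_hd f s = F s"
    and B: "\<And>s. s \<in> half_plane 0 \<Longrightarrow> cmod (F s) \<le> B"
  shows "norm f \<le> B"
proof -
  obtain g where "\<forall>s\<in>half_plane (1/2). eval_hd g s = F s" "norm g \<le> B"
    using uniform_dirichlet_in_hd[OF F B] by blast
  moreover from this f have "f = g" by (intro eval_hd_determines) simp
  ultimately show ?thesis by simp
qed

section \<open>Compact operators\<close>

text \<open>In a complete space relative compactness is total boundedness. The finite nets are what the
  continuity arguments use.\<close>

lemma compact_operator_iff_nets:
  fixes T :: "'a::real_normed_vector \<Rightarrow>\<^sub>L 'b::banach"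
  shows "compact_operator T \<longleftrightarrow>
    (\<forall>e>0. \<exists>W. finite W \<and> (\<forall>x\<in>cball 0 1. \<exists>w\<in>W. norm (blinfun_apply T x - w) < e))"
    (is "_ = ?net")
proof
  let ?I = "blinfun_apply T ` cball 0 1"
  assume "compact_operator T"
  then have tb: "\<exists>W. finite W \<and> closure ?I \<subseteq> (\<Union>w\<in>W. ball w e)" if "e > 0" for e
    using that unfolding compact_operator_def compact_eq_totally_bounded by blast
  show ?net
  proof (intro allI impI)
    fix e :: real assume "e > 0"
    then obtain W where W: "finite W" "closure ?I \<subseteq> (\<Union>w\<in>W. ball w e)" using tb by blast
    have "\<exists>w\<in>W. norm (blinfun_apply T x - w) < e" if "x \<in> cball 0 1" for x
    proof -
      have "blinfun_apply T x \<in> closure ?I" by (rule subsetD[OF closure_subset imageI[OF that]])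
      with W(2) obtain w where "w \<in> W" "blinfun_apply T x \<in> ball w e" by blast
      then show ?thesis by (intro bexI[of _ w]) (simp_all add: dist_norm norm_minus_commute)
    qed
    with W(1) show "\<exists>W. finite W \<and> (\<forall>x\<in>cball 0 1. \<exists>w\<in>W. norm (blinfun_apply T x - w) < e)"
      by blast
  qed
next
  let ?I = "blinfun_apply T ` cball 0 1"
  assume net: ?net
  have "\<exists>W. finite W \<and> closure ?I \<subseteq> (\<Union>w\<in>W. ball w e)" if "e > 0" for e :: real
  proof -
    from that have "e / 2 > 0" by simp
    then obtain W where W: "finite W" "\<forall>x\<in>cball 0 1. \<exists>w\<in>W. norm (blinfun_apply T x - w) < e / 2"
      using net by meson
    have "?I \<subseteq> (\<Union>w\<in>W. cball w (e / 2))"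
    proof
      fix y assume "y \<in> ?I"
      then obtain x where "x \<in> cball 0 1" "y = blinfun_apply T x" by blast
      with W(2) obtain w where "w \<in> W" "norm (y - w) < e / 2" by blast
      then show "y \<in> (\<Union>w\<in>W. cball w (e / 2))"
        by (auto simp: dist_norm norm_minus_commute intro!: bexI[of _ w])
    qed
    then have "closure ?I \<subseteq> (\<Union>w\<in>W. cball w (e / 2))"
      by (rule closure_minimal) (use W(1) in auto)
    also have "\<dots> \<subseteq> (\<Union>w\<in>W. ball w e)"
      using \<open>e > 0\<close> by fastforce
    finally show ?thesis using W(1) by blast
  qed
  then show "compact_operator T"
    unfolding compact_operator_def compact_eq_totally_bounded
    by (simp add: complete_eq_closed)
qed

lemma compact_operator_limit:
  fixes T :: "'a::real_normed_vector \<Rightarrow>\<^sub>L 'b::banach"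
  assumes lim: "X \<longlonglongrightarrow> T" and X: "\<And>N::nat. compact_operator (X N)"
  shows "compact_operator T"
  unfolding compact_operator_iff_nets
proof (intro allI impI)
  fix e :: real assume "e > 0"
  then have e: "e / 2 > 0" by simp
  from LIMSEQ_D[OF lim e] obtain N where N: "norm (X N - T) < e / 2" by blast
  obtain W where W: "finite W" "\<forall>x\<in>cball 0 1. \<exists>w\<in>W. norm (blinfun_apply (X N) x - w) < e / 2"
    using X[of N] e unfolding compact_operator_iff_nets by meson
  have "\<exists>w\<in>W. norm (blinfun_apply T x - w) < e" if x: "x \<in> cball 0 1" for x
  proof -
    obtain w where w: "w \<in> W" "norm (blinfun_apply (X N) x - w) < e / 2" using W(2) x by blast
    have "norm (blinfun_apply (X N - T) x) \<le> norm (X N - T) * norm x" by (rule norm_blinfun)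
    also have "\<dots> \<le> norm (X N - T)" using x by (simp add: mult_left_le)
    finally have "norm (blinfun_apply T x - blinfun_apply (X N) x) < e / 2"
      using N by (simp add: blinfun.diff_left norm_minus_commute)
    from norm_diff_triangle_less[OF this w(2)] w(1) show ?thesis by auto
  qed
  with W(1) show "\<exists>W. finite W \<and> (\<forall>x\<in>cball 0 1. \<exists>w\<in>W. norm (blinfun_apply T x - w) < e)"
    by blast
qed

lemma compact_operator_add:
  fixes S T :: "'a::real_normed_vector \<Rightarrow>\<^sub>L 'b::banach"
  assumes "compact_operator S" "compact_operator T"
  shows "compact_operator (S + T)"
  unfolding compact_operator_iff_nets
proof (intro allI impI)
  fix e :: real assume "e > 0"
  then have e: "e / 2 > 0" by simp
  obtain V where V: "finite V" "\<forall>x\<in>cball 0 1. \<exists>w\<in>V. norm (blinfun_apply S x - w) < e / 2"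
    using assms(1) e unfolding compact_operator_iff_nets by meson
  obtain W where W: "finite W" "\<forall>x\<in>cball 0 1. \<exists>w\<in>W. norm (blinfun_apply T x - w) < e / 2"
    using assms(2) e unfolding compact_operator_iff_nets by meson
  have "\<exists>w\<in>(\<lambda>(v, w). v + w) ` (V \<times> W). norm (blinfun_apply (S + T) x - w) < e"
    if x: "x \<in> cball 0 1" for x
  proof -
    obtain v w where vw: "v \<in> V" "w \<in> W" "norm (blinfun_apply S x - v) < e / 2"
      "norm (blinfun_apply T x - w) < e / 2" using V(2) W(2) x by blast
    have "norm ((blinfun_apply S x - v) + (blinfun_apply T x - w)) < e / 2 + e / 2"
      by (rule norm_add_less[OF vw(3,4)])
    moreover have "(blinfun_apply S x - v) + (blinfun_apply T x - w) = blinfun_apply (S + T) x - (v + w)"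
      by (simp add: blinfun.add_left)
    ultimately show ?thesis using vw(1,2) by (intro bexI[of _ "v + w"]) auto
  qed
  then show "\<exists>W. finite W \<and> (\<forall>x\<in>cball 0 1. \<exists>w\<in>W. norm (blinfun_apply (S + T) x - w) < e)"
    using V(1) W(1) by (intro exI[of _ "(\<lambda>(v, w). v + w) ` (V \<times> W)"]) auto
qed

lemma compact_operator_zero: "compact_operator (0 :: 'a::real_normed_vector \<Rightarrow>\<^sub>L 'b::real_normed_vector)"
proof -
  have eq: "blinfun_apply (0 :: 'a \<Rightarrow>\<^sub>L 'b) ` cball 0 1 = {0}"
    by (auto simp: image_iff intro!: exI[of _ 0])
  show ?thesis unfolding compact_operator_def eq by simp
qed

lemma compact_operator_sum:
  fixes T :: "'i \<Rightarrow> 'a::real_normed_vector \<Rightarrow>\<^sub>L 'b::banach"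
  assumes "\<And>i. i \<in> A \<Longrightarrow> compact_operator (T i)"
  shows "compact_operator (\<Sum>i\<in>A. T i)"
  using assms
  by (induction A rule: infinite_finite_induct)
    (simp_all add: compact_operator_zero compact_operator_add)

lemma compact_operator_compose_contractions:
  fixes A :: "'b::banach \<Rightarrow>\<^sub>L 'c::banach" and B :: "'d::real_normed_vector \<Rightarrow>\<^sub>L 'a::real_normed_vector"
  assumes K: "compact_operator K"
    and A: "\<And>x. norm (blinfun_apply A x) \<le> norm x" and B: "\<And>x. norm (blinfun_apply B x) \<le> norm x"
  shows "compact_operator (A o\<^sub>L K o\<^sub>L B)"
  unfolding compact_operator_iff_nets
proof (intro allI impI)
  fix e :: real assume "e > 0"
  then obtain W where W: "finite W" "\<forall>x\<in>cball 0 1. \<exists>w\<in>W. norm (blinfun_apply K x - w) < e"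
    using K unfolding compact_operator_iff_nets by meson
  have "\<exists>w\<in>blinfun_apply A ` W. norm (blinfun_apply (A o\<^sub>L K o\<^sub>L B) x - w) < e"
    if x: "x \<in> cball 0 1" for x
  proof -
    have "blinfun_apply B x \<in> cball 0 1" using x B[of x] by simp
    with W(2) obtain w where w: "w \<in> W" "norm (blinfun_apply K (blinfun_apply B x) - w) < e" by blast
    have "norm (blinfun_apply A (blinfun_apply K (blinfun_apply B x) - w)) < e"
      using A w(2) le_less_trans by blast
    with w(1) show ?thesis by (auto simp: blinfun.diff_right)
  qed
  with W(1) show "\<exists>W. finite W \<and> (\<forall>x\<in>cball 0 1. \<exists>w\<in>W. norm (blinfun_apply (A o\<^sub>L K o\<^sub>L B) x - w) < e)"
    by blast
qed

lemma norm_blinfun_le_unit_ball: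
  assumes "b \<ge> 0" "\<And>x. norm x \<le> 1 \<Longrightarrow> norm (blinfun_apply A x) \<le> b"
  shows "norm A \<le> b"
proof (rule norm_blinfun_bound)
  fix x
  show "norm (blinfun_apply A x) \<le> b * norm x"
  proof (cases "x = 0")
    case False
    have "norm (blinfun_apply A (x /\<^sub>R norm x)) \<le> b"
      by (rule assms) (use False in simp)
    with False show ?thesis by (simp add: blinfun.scaleR_right divide_simps mult.commute)
  qed simp
qed fact

section \<open>Compressing a compact operator by translations\<close>

lift_definition translation :: "real \<Rightarrow> hardy_dirichlet \<Rightarrow>\<^sub>L hardy_dirichlet" is translate_hd
  by (rule bounded_linear_translate_hd)

lemma norm_translation_apply_le: "norm (blinfun_apply (translation t) f) \<le> norm f"
  by (simp add: translation.rep_eq norm_translate_hd_le)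

lemma norm_translation_le: "norm (translation t) \<le> 1"
  by (rule norm_blinfun_bound) (simp_all add: norm_translation_apply_le)

lemma eventually_translate_hd_near:
  assumes "finite W" "e > 0"
  shows "\<forall>\<^sub>F t in at u. \<forall>w\<in>W. norm (translate_hd t w - translate_hd u w) < e"
proof (rule eventually_ball_finite[OF assms(1)], rule ballI)
  fix w
  have "((\<lambda>t. translate_hd t w) \<longlongrightarrow> translate_hd u w) (at u)"
    using continuous_on_translate_hd[of w] by (auto simp: continuous_on_def)
  from tendstoD[OF this assms(2)]
  show "\<forall>\<^sub>F t in at u. norm (translate_hd t w - translate_hd u w) < e"
    by (simp add: dist_norm)
qed

text \<open>Strong convergence is uniform on a finite net for the image of the unit ball, and contractivity
  carries it to the whole image.\<close>

lemma translation_compose_compact_tendsto: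
  assumes K: "compact_operator K"
  shows "((\<lambda>t. translation t o\<^sub>L K) \<longlongrightarrow> translation u o\<^sub>L K) (at u)"
proof (rule tendstoI)
  fix e :: real assume "e > 0"
  then have e: "e / 4 > 0" by simp
  obtain W where W: "finite W" "\<forall>x\<in>cball 0 1. \<exists>w\<in>W. norm (blinfun_apply K x - w) < e / 4"
    using K e unfolding compact_operator_iff_nets by meson
  from eventually_translate_hd_near[OF W(1) e, of u]
  show "\<forall>\<^sub>F t in at u. dist (translation t o\<^sub>L K) (translation u o\<^sub>L K) < e"
  proof eventually_elim
    case (elim t)
    have "norm ((translation t o\<^sub>L K) - (translation u o\<^sub>L K)) \<le> 3 * (e / 4)"
    proof (rule norm_blinfun_le_unit_ball)
      fix x :: 'a assume "norm x \<le> 1"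
      then have "x \<in> cball 0 1" by simp
      with W(2) obtain w where w: "w \<in> W" "norm (blinfun_apply K x - w) < e / 4"
        by blast
      define y where "y = blinfun_apply K x"
      have lin: "translate_hd v (y - w) = translate_hd v y - translate_hd v w" for v
        by (rule linear_diff[OF bounded_linear.linear[OF bounded_linear_translate_hd]])
      have "translate_hd t y - translate_hd u y
          = translate_hd t (y - w) + (translate_hd t w - translate_hd u w) - translate_hd u (y - w)"
        by (simp add: lin)
      also have "norm \<dots> \<le> norm (translate_hd t (y - w)) + norm (translate_hd t w - translate_hd u w)
          + norm (translate_hd u (y - w))"
        by (rule order_trans[OF norm_triangle_ineq4]) (rule add_right_mono, rule norm_triangle_ineq)
      also have "\<dots> \<le> e / 4 + e / 4 + e / 4"
        using w elim norm_translate_hd_le[of t "y - w"] norm_translate_hd_le[of u "y - w"]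
        by (intro add_mono) (auto simp: y_def intro: order_trans less_imp_le)
      finally show "norm (blinfun_apply ((translation t o\<^sub>L K) - (translation u o\<^sub>L K)) x) \<le> 3 * (e / 4)"
        by (simp add: blinfun.diff_left translation.rep_eq y_def)
    qed (use \<open>e > 0\<close> in simp)
    also have "\<dots> < e" using \<open>e > 0\<close> by simp
    finally show ?case by (simp add: dist_norm)
  qed
qed

text \<open>For \<open>y = (translate_hd t x - translate_hd u x) / 2\<close> in the unit ball choose \<open>w\<close> in a finite
  net near \<open>K y\<close>. Then \<open>(norm (K y))\<^sup>2\<close> is close to \<open>inner (K y) w = inner y (k w)\<close>, where
  \<open>k w\<close> represents the functional \<open>f \<mapsto> inner (K f) w\<close>. Moving the translations
  to the finitely many vectors \<open>k w\<close> leaves a quantity small uniformly in \<open>x\<close>. This takes the place of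
  Schauder's theorem on the compactness of the adjoint.\<close>

lemma compact_compose_translation_tendsto:
  fixes K :: "hardy_dirichlet \<Rightarrow>\<^sub>L 'b::{real_inner, banach}"
  assumes K: "compact_operator K"
  shows "((\<lambda>t. K o\<^sub>L translation t) \<longlongrightarrow> K o\<^sub>L translation u) (at u)"
proof (rule tendstoI)
  fix e :: real assume "e > 0"
  \<comment> \<open>The two summands of \<open>(norm (K y))\<^sup>2\<close> are to be at most \<open>e\<^sup>2 / 32\<close> each, which gives
    \<open>norm (K y) \<le> e / 4\<close>.\<close>
  define d where "d = e\<^sup>2 / (32 * (norm K + 1))"
  have K1: "norm K + 1 > 0" by (simp add: add_nonneg_pos)
  then have "d > 0" using \<open>e > 0\<close> by (simp add: d_def)
  then obtain W where W: "finite W" "\<forall>x\<in>cball 0 1. \<exists>w\<in>W. norm (blinfun_apply K x - w) < d"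
    using K unfolding compact_operator_iff_nets by meson
  have "\<exists>v. \<forall>f. inner (blinfun_apply K f) w = inner f v" for w
    by (rule Riesz_representation_hd)
      (intro bounded_linear_compose[OF bounded_linear_inner_left] blinfun.bounded_linear_right)
  then obtain k where k: "\<And>f w. inner (blinfun_apply K f) w = inner f (k w)"
    by metis
  have "finite (k ` W)" "e\<^sup>2 / 16 > 0" using W(1) \<open>e > 0\<close> by auto
  from eventually_translate_hd_near[OF this, of u]
  show "\<forall>\<^sub>F t in at u. dist (K o\<^sub>L translation t) (K o\<^sub>L translation u) < e"
  proof eventually_elim
    case (elim t)
    have "norm ((K o\<^sub>L translation t) - (K o\<^sub>L translation u)) \<le> e / 2"
    proof (rule norm_blinfun_le_unit_ball)
      fix x :: hardy_dirichlet assume x: "norm x \<le> 1"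
      define y where "y = (1/2) *\<^sub>R (translate_hd t x - translate_hd u x)"
      have "norm (translate_hd t x - translate_hd u x) \<le> 2"
        using norm_triangle_ineq4[of "translate_hd t x" "translate_hd u x"]
          norm_translate_hd_le[of t x] norm_translate_hd_le[of u x] x by linarith
      then have y: "norm y \<le> 1" by (simp add: y_def)
      then have "y \<in> cball 0 1" by simp
      with W(2) obtain w where w: "w \<in> W" "norm (blinfun_apply K y - w) < d"
        by blast
      have Ky: "norm (blinfun_apply K y) \<le> norm K"
        using norm_blinfun[of K y] y by (meson mult_left_le norm_ge_zero order_trans)
      have "inner (blinfun_apply K y) (blinfun_apply K y - w) \<le> norm K * d"
        using norm_cauchy_schwarz[of "blinfun_apply K y" "blinfun_apply K y - w"]
          mult_mono[OF Ky less_imp_le[OF w(2)]] by simp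
      also have "\<dots> \<le> (norm K + 1) * d" using \<open>d > 0\<close> by simp
      also have "\<dots> = e\<^sup>2 / 32" unfolding d_def using K1 by (simp add: divide_simps)
      finally have 1: "inner (blinfun_apply K y) (blinfun_apply K y - w) \<le> e\<^sup>2 / 32" .
      have "inner (blinfun_apply K y) w = (1/2) * inner x (translate_hd t (k w) - translate_hd u (k w))"
        by (simp add: k y_def inner_diff_left inner_diff_right inner_translate_hd)
      also have "\<dots> \<le> (1/2) * (norm x * norm (translate_hd t (k w) - translate_hd u (k w)))"
        by (intro mult_left_mono norm_cauchy_schwarz) auto
      also have "\<dots> \<le> (1/2) * (1 * (e\<^sup>2 / 16))"
        using elim w(1) x by (intro mult_left_mono mult_mono) (auto intro: less_imp_le)
      finally have 2: "inner (blinfun_apply K y) w \<le> e\<^sup>2 / 32" by simp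
      have "(norm (blinfun_apply K y))\<^sup>2 \<le> e\<^sup>2 / 32 + e\<^sup>2 / 32"
        using 1 2 by (simp add: power2_norm_eq_inner inner_diff_right)
      also have "\<dots> = (e / 4)\<^sup>2" by (simp add: power2_eq_square)
      finally have "norm (blinfun_apply K y) \<le> e / 4"
        by (rule power2_le_imp_le) (use \<open>e > 0\<close> in simp)
      then show "norm (blinfun_apply ((K o\<^sub>L translation t) - (K o\<^sub>L translation u)) x) \<le> e / 2"
        by (simp add: y_def blinfun.diff_left translation.rep_eq blinfun.scaleR_right blinfun.diff_right)
    qed (use \<open>e > 0\<close> in simp)
    also have "\<dots> < e" using \<open>e > 0\<close> by simp
    finally show ?case by (simp add: dist_norm)
  qed
qed

text \<open>The outer factors are not norm-continuous by themselves, so the difference is split such that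
  each varying translation is next to \<open>K\<close> and the remaining one only contributes its norm.\<close>

lemma continuous_on_compression:
  assumes K: "compact_operator K"
  shows "continuous_on UNIV (\<lambda>t. translation t o\<^sub>L K o\<^sub>L translation t)"
  unfolding continuous_on_def
proof
  fix u
  let ?g = "\<lambda>t. norm ((K o\<^sub>L translation t) - (K o\<^sub>L translation u))
      + norm ((translation t o\<^sub>L K) - (translation u o\<^sub>L K))"
  have "((\<lambda>t. (translation t o\<^sub>L K o\<^sub>L translation t) - (translation u o\<^sub>L K o\<^sub>L translation u)) \<longlongrightarrow> 0) (at u)"
  proof (rule Lim_null_comparison)
    show "(?g \<longlongrightarrow> 0) (at u)"
      by (intro tendsto_add_zero tendsto_norm_zero LIM_zero compact_compose_translation_tendsto
          translation_compose_compact_tendsto K)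
    have "norm ((translation t o\<^sub>L K o\<^sub>L translation t) - (translation u o\<^sub>L K o\<^sub>L translation u)) \<le> ?g t" for t
    proof -
      have "(translation t o\<^sub>L K o\<^sub>L translation t) - (translation u o\<^sub>L K o\<^sub>L translation u)
          = (translation t o\<^sub>L ((K o\<^sub>L translation t) - (K o\<^sub>L translation u)))
          + (((translation t o\<^sub>L K) - (translation u o\<^sub>L K)) o\<^sub>L translation u)"
        by (rule blinfun_eqI) (simp add: blinfun.add_left blinfun.diff_left blinfun.diff_right)
      also have "norm \<dots> \<le> norm (translation t) * norm ((K o\<^sub>L translation t) - (K o\<^sub>L translation u))
          + norm ((translation t o\<^sub>L K) - (translation u o\<^sub>L K)) * norm (translation u)"
        by (rule order_trans[OF norm_triangle_ineq]) (intro add_mono norm_blinfun_compose)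
      also have "\<dots> \<le> ?g t"
        using norm_translation_le[of t] norm_translation_le[of u]
        by (intro add_mono) (auto intro: mult_left_le mult_left_le_one_le)
      finally show ?thesis .
    qed
    then show "\<forall>\<^sub>F t in at u. norm ((translation t o\<^sub>L K o\<^sub>L translation t) - (translation u o\<^sub>L K o\<^sub>L translation u)) \<le> ?g t"
      by simp
  qed
  then show "((\<lambda>t. translation t o\<^sub>L K o\<^sub>L translation t) \<longlongrightarrow> translation u o\<^sub>L K o\<^sub>L translation u) (at u)"
    by (rule LIM_zero_cancel)
qed

section \<open>Absolutely convergent series of rank-one operators\<close>

lift_definition rank_one :: "nat \<Rightarrow> hardy_dirichlet \<Rightarrow> hardy_dirichlet \<Rightarrow>\<^sub>L hardy_dirichlet"
  is "\<lambda>n h f. cscale_hd (coeff_hd f n) h"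
  by (intro bounded_linear_compose[OF bounded_bilinear.bounded_linear_left[OF bounded_bilinear_cscale_hd]]
      bounded_linear_coeff_hd)

lemma norm_rank_one_le: "norm (rank_one n h) \<le> norm h"
  by (rule norm_blinfun_bound)
    (auto simp: rank_one.rep_eq norm_cscale_hd mult.commute[of _ "norm h"] intro!: mult_left_mono coeff_hd_le_norm)

lemma bounded_linear_rank_one: "bounded_linear (rank_one n)"
proof (rule bounded_linear_intro[of _ 1])
  fix g h r
  show "rank_one n (g + h) = rank_one n g + rank_one n h"
    by (rule blinfun_eqI, rule hd_eqI) (simp add: blinfun.add_left rank_one.rep_eq algebra_simps)
  show "rank_one n (r *\<^sub>R h) = r *\<^sub>R rank_one n h"
    by (rule blinfun_eqI, rule hd_eqI) (simp add: blinfun.scaleR_left rank_one.rep_eq)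
qed (simp add: norm_rank_one_le)

lemma compact_operator_rank_one: "compact_operator (rank_one n h)"
proof -
  let ?C = "(\<lambda>z. cscale_hd z h) ` cball 0 1"
  have "compact ?C"
    by (intro compact_continuous_image linear_continuous_on compact_cball
        bounded_bilinear.bounded_linear_left[OF bounded_bilinear_cscale_hd])
  moreover have "blinfun_apply (rank_one n h) ` cball 0 1 \<subseteq> ?C"
    using coeff_hd_le_norm order_trans by (fastforce simp: rank_one.rep_eq)
  then have "closure (blinfun_apply (rank_one n h) ` cball 0 1) \<subseteq> ?C"
    by (rule closure_minimal) (rule compact_imp_closed, fact)
  ultimately show ?thesis
    unfolding compact_operator_def by (metis closed_closure compact_Int_closed inf.absorb2)
qed

text \<open>The Weierstrass test in the space of bounded operators: uniform convergence passes both
  continuity in the parameter and compactness to the sum.\<close>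

lemma rank_one_series:
  assumes cont: "\<And>n. continuous_on S (h n)" and bound: "\<And>n t. t \<in> S \<Longrightarrow> norm (h n t) \<le> M n"
    and M: "summable M"
  defines "A \<equiv> \<lambda>t. \<Sum>n. rank_one n (h n t)"
  shows "continuous_on S A"
    and "t \<in> S \<Longrightarrow> compact_operator (A t)"
    and "t \<in> S \<Longrightarrow> (\<lambda>n. cscale_hd (coeff_hd f n) (h n t)) sums blinfun_apply (A t) f"
proof -
  have ul: "uniform_limit S (\<lambda>N t. \<Sum>n<N. rank_one n (h n t)) A sequentially"
    unfolding A_def
    by (rule Weierstrass_m_test[OF _ M]) (meson norm_rank_one_le bound order_trans)
  show "continuous_on S A"
    by (rule uniform_limit_theorem[OF _ ul])
      (auto intro!: always_eventually continuous_on_sum bounded_linear.continuous_on[OF bounded_linear_rank_one] cont)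
  assume t: "t \<in> S"
  have lim: "(\<lambda>N. \<Sum>n<N. rank_one n (h n t)) \<longlonglongrightarrow> A t"
    by (rule tendsto_uniform_limitI[OF ul t])
  show "compact_operator (A t)"
    by (rule compact_operator_limit[OF lim]) (intro compact_operator_sum compact_operator_rank_one)
  have "(\<lambda>N. blinfun_apply (\<Sum>n<N. rank_one n (h n t)) f) \<longlonglongrightarrow> blinfun_apply (A t) f"
    by (intro blinfun.tendsto lim tendsto_const)
  then show "(\<lambda>n. cscale_hd (coeff_hd f n) (h n t)) sums blinfun_apply (A t) f"
    unfolding sums_def by (simp add: blinfun.sum_left rank_one.rep_eq)
qed

section \<open>Composition operators whose symbol lies deep in the half-plane\<close>

text \<open>The exponential is bounded by 1 on the convex left half-plane.\<close>

lemma norm_exp_diff_le: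
  fixes a b :: complex
  assumes "Re a \<le> 0" "Re b \<le> 0"
  shows "cmod (exp a - exp b) \<le> cmod (a - b)"
proof -
  have "cmod (exp a - exp b) \<le> 1 * cmod (a - b)"
  proof (rule field_differentiable_bound[of "{z. Re z \<le> 0}" exp exp])
    show "convex {z. Re z \<le> 0}" by (rule convex_halfspace_Re_le)
    show "(exp has_field_derivative exp z) (at z within {z. Re z \<le> 0})" for z :: complex
      by (rule DERIV_subset[OF DERIV_exp]) simp
  qed (use assms in auto)
  then show ?thesis by simp
qed

lemma of_nat_powr_exp:
  assumes "n \<ge> 1"
  shows "(of_nat n powr z :: complex) = exp (of_real (ln (real n)) * z)"
  using assms by (simp add: powr_def Ln_of_nat mult.commute)

text \<open>The operator with symbol \<open>\<phi>\<close> is the series of \<open>coeff_hd f n\<close> times the element of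
  \<open>\<H>\<close> given by \<open>F n x s = n powr - \<phi> s\<close>. Depth 2 of the symbol makes the norms of these elements
  at most \<open>n powr -2\<close>, hence summable, and each depends on the parameter with a Lipschitz
  constant of order \<open>ln n\<close>, which may grow because the Weierstrass test asks for continuity of
  each term only.\<close>

lemma composition_operator_family:
  fixes \<psi> :: "real \<Rightarrow> complex \<Rightarrow> complex" and c0 :: nat
  assumes \<psi>: "\<And>x. x \<in> S \<Longrightarrow> uniform_dirichlet (\<psi> x)"
    and deep: "\<And>x s. x \<in> S \<Longrightarrow> s \<in> half_plane 0 \<Longrightarrow> Re (\<psi> x s) \<ge> 2"
    and lip: "\<And>x y s. x \<in> S \<Longrightarrow> y \<in> S \<Longrightarrow> s \<in> half_plane 0 \<Longrightarrow> cmod (\<psi> x s - \<psi> y s) \<le> L * \<bar>x - y\<bar>"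
    and L: "L \<ge> 0"
  obtains A where "continuous_on S A" "\<And>x. x \<in> S \<Longrightarrow> compact_operator (A x)"
    "\<And>x. x \<in> S \<Longrightarrow> is_composition_operator (\<lambda>s. of_nat c0 * s + \<psi> x s) (A x)"
proof -
  define F where "F n x s = (of_nat n powr - (of_nat c0 * s + \<psi> x s) :: complex)" for n x s
  have F_exp: "F n x s = exp (of_real (ln (real n)) * - (of_nat c0 * s + \<psi> x s))" if "n \<ge> 1" for n x s
    unfolding F_def by (rule of_nat_powr_exp[OF that])
  have F_0: "F 0 x s = 0" for x s by (simp add: F_def)
  have re: "Re (of_nat c0 * s + \<psi> x s) \<ge> 2" if "x \<in> S" "s \<in> half_plane 0" for x s
  proof -
    have "0 \<le> real c0 * Re s" using that(2) by (simp add: half_plane_def)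
    with deep[OF that] show ?thesis by simp
  qed
  have F_ud: "uniform_dirichlet (F n x)" if "x \<in> S" for n x
  proof (cases "n = 0")
    case True
    then show ?thesis by (simp add: F_0[abs_def] uniform_dirichlet_const)
  next
    case False
    have "uniform_dirichlet (\<lambda>s. (1 * of_nat n powr - s) ^ c0 * exp (of_real (- ln (real n)) * \<psi> x s))"
      by (intro uniform_dirichlet_mult uniform_dirichlet_power uniform_dirichlet_monomial
          uniform_dirichlet_exp uniform_dirichlet_const \<psi> that)
    moreover have "(1 * of_nat n powr - s) ^ c0 * exp (of_real (- ln (real n)) * \<psi> x s) = F n x s" for s
      using False by (simp add: F_exp of_nat_powr_exp algebra_simps flip: exp_of_nat_mult exp_add)
    ultimately show ?thesis by simp
  qed
  have F_le: "cmod (F n x s) \<le> real n powr - 2" if "x \<in> S" "s \<in> half_plane 0" for n x s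
  proof (cases "n = 0")
    case False
    then show ?thesis
      unfolding F_def norm_of_nat_powr using re[OF that] by (intro powr_mono) auto
  qed (simp add: F_0)
  have F_lip: "cmod (F n x s - F n y s) \<le> ln (real n) * L * \<bar>x - y\<bar>"
    if "x \<in> S" "y \<in> S" and s: "s \<in> half_plane 0" for n x y s
  proof (cases "n = 0")
    case False
    let ?a = "\<lambda>x. of_real (ln (real n)) * - (of_nat c0 * s + \<psi> x s) :: complex"
    have ln: "ln (real n) \<ge> 0" using False by simp
    have neg: "Re (?a z) \<le> 0" if "z \<in> S" for z
    proof -
      have "0 \<le> ln (real n) * Re (of_nat c0 * s + \<psi> z s)"
        using ln re[OF that s] by (intro mult_nonneg_nonneg) linarith+
      moreover have "Re (?a z) = - (ln (real n) * Re (of_nat c0 * s + \<psi> z s))"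
        by (simp add: algebra_simps)
      ultimately show ?thesis by linarith
    qed
    have "cmod (F n x s - F n y s) \<le> cmod (?a x - ?a y)"
      using False norm_exp_diff_le[OF neg[OF that(1)] neg[OF that(2)]] by (simp add: F_exp)
    also have "?a x - ?a y = of_real (ln (real n)) * - (\<psi> x s - \<psi> y s)"
      by (simp add: algebra_simps)
    also have "cmod \<dots> = ln (real n) * cmod (\<psi> x s - \<psi> y s)"
      unfolding norm_mult norm_minus_cancel norm_of_real using ln by simp
    also have "\<dots> \<le> ln (real n) * (L * \<bar>x - y\<bar>)"
      by (intro mult_left_mono lip that ln)
    finally show ?thesis by (simp add: mult.assoc)
  qed (simp add: F_0)
  have ex: "\<exists>f. (\<forall>s\<in>half_plane (1/2). eval_hd f s = F n x s) \<and> norm f \<le> real n powr - 2" if "x \<in> S" for n x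
    by (rule uniform_dirichlet_in_hd) (use F_ud F_le that in auto)
  define h where "h n x = (SOME f. (\<forall>s\<in>half_plane (1/2). eval_hd f s = F n x s) \<and> norm f \<le> real n powr - 2)" for n x
  have h: "eval_hd (h n x) s = F n x s" if "x \<in> S" "s \<in> half_plane (1/2)" for n x s
    using someI_ex[OF ex[OF that(1), of n]] that(2) unfolding h_def by blast
  have h_le: "norm (h n x) \<le> real n powr - 2" if "x \<in> S" for n x
    using someI_ex[OF ex[OF that, of n]] unfolding h_def by blast
  have cont: "continuous_on S (h n)" for n
  proof (rule lipschitz_on_continuous_on, rule lipschitz_onI)
    show "0 \<le> ln (real n) * L" using L by (cases "n = 0") auto
    fix x y assume xy: "x \<in> S" "y \<in> S"
    have "norm (h n x - h n y) \<le> ln (real n) * L * \<bar>x - y\<bar>"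
    proof (rule norm_le_sup_uniform_dirichlet)
      show "uniform_dirichlet (\<lambda>s. F n x s + (-1) * F n y s)"
        by (intro uniform_dirichlet_add uniform_dirichlet_mult uniform_dirichlet_const F_ud xy)
      show "cmod (F n x s + (-1) * F n y s) \<le> ln (real n) * L * \<bar>x - y\<bar>" if "s \<in> half_plane 0" for s
        using F_lip[OF xy that] by simp
      show "eval_hd (h n x - h n y) s = F n x s + (-1) * F n y s" if "s \<in> half_plane (1/2)" for s
        using linear_diff[OF bounded_linear.linear[OF bounded_linear_eval_hd], of s] that h[OF _ that] xy
        by (simp add: half_plane_def)
    qed
    then show "dist (h n x) (h n y) \<le> ln (real n) * L * dist x y"
      by (simp add: dist_norm)
  qed
  have M: "summable (\<lambda>n. real n powr - 2)" by (simp add: summable_real_powr_iff)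
  define A where "A = (\<lambda>x. \<Sum>n. rank_one n (h n x))"
  note series = rank_one_series[of S h, OF cont _ M]
  show ?thesis
  proof
    show "continuous_on S A" unfolding A_def by (rule series(1)) (rule h_le)
    show "compact_operator (A x)" if "x \<in> S" for x unfolding A_def using h_le that by (rule series(2))
    show "is_composition_operator (\<lambda>s. of_nat c0 * s + \<psi> x s) (A x)" if x: "x \<in> S" for x
      unfolding is_composition_operator_def
    proof (intro allI ballI)
      fix f s assume s: "s \<in> half_plane (1/2)"
      then have s': "Re s > 1/2" by (simp add: half_plane_def)
      have "(\<lambda>n. cscale_hd (coeff_hd f n) (h n x)) sums blinfun_apply (A x) f"
        unfolding A_def using h_le x by (rule series(3))
      then have "(\<lambda>n. eval_hd (cscale_hd (coeff_hd f n) (h n x)) s) sums eval_hd (blinfun_apply (A x) f) s"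
        by (rule bounded_linear.sums[OF bounded_linear_eval_hd[OF s']])
      then have "(\<lambda>n. coeff_hd f n * of_nat n powr - (of_nat c0 * s + \<psi> x s)) sums eval_hd (blinfun_apply (A x) f) s"
        by (simp add: eval_cscale_hd[OF s'] h[OF x s] F_def)
      then show "eval_hd (blinfun_apply (A x) f) s = eval_hd f (of_nat c0 * s + \<psi> x s)"
        by (simp add: eval_hd_def[of f] dirichlet_series_def sums_iff)
    qed
  qed
qed

section \<open>Symbols\<close>

lemma uniform_limit_dirichlet_series:
  assumes "uniformly_convergent_on X (dirichlet_partial_sum c)"
  shows "uniform_limit X (dirichlet_partial_sum c) (dirichlet_series c) sequentially"
proof -
  obtain l where l: "uniform_limit X (dirichlet_partial_sum c) l sequentially"
    using assms by (auto simp: uniformly_convergent_on_def)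
  have "dirichlet_series c s = l s" if "s \<in> X" for s
    using tendsto_uniform_limitI[OF l that]
    by (simp add: dirichlet_series_def dirichlet_partial_sum_def sums_def[symmetric] sums_iff)
  then show ?thesis using l by (metis (no_types, lifting) uniform_limit_cong')
qed

text \<open>The constant \<open>a\<close> is the coefficient at \<open>n = 1\<close>, so it is present as soon as \<open>N \<ge> 2\<close>.\<close>

lemma dirichlet_partial_sum_affine:
  assumes "c' = (\<lambda>n. b * (c n * of_real (real n powr - t)) + (if n = 1 then a else 0))"
  shows "dirichlet_partial_sum c' N s
    = b * dirichlet_partial_sum c N (s + of_real t) + (if N \<ge> 2 then a else 0)"
proof -
  have "dirichlet_partial_sum c' N s
      = (\<Sum>n<N. b * (c n * of_nat n powr - (s + of_real t)) + (if n = 1 then a else 0))"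
    unfolding dirichlet_partial_sum_def of_nat_powr_minus_add_of_real assms
    by (intro sum.cong) (auto simp: algebra_simps)
  also have "\<dots> = b * dirichlet_partial_sum c N (s + of_real t) + (\<Sum>n<N. if n = 1 then a else 0)"
    by (simp only: sum.distrib sum_distrib_left dirichlet_partial_sum_def)
  finally show ?thesis by auto
qed

lemma affine_dirichlet_series:
  fixes a b :: complex
  assumes unif: "\<forall>\<epsilon>>0. uniformly_convergent_on (half_plane \<epsilon>) (dirichlet_partial_sum c)" and t: "t \<ge> 0"
  obtains c' where "\<forall>\<epsilon>>0. uniformly_convergent_on (half_plane \<epsilon>) (dirichlet_partial_sum c')"
    "\<And>s. s \<in> half_plane 0 \<Longrightarrow> dirichlet_series c' s = b * dirichlet_series c (s + of_real t) + a"
proof -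
  define c' where "c' = (\<lambda>n. b * (c n * of_real (real n powr - t)) + (if n = 1 then a else 0))"
  note part = dirichlet_partial_sum_affine[OF c'_def]
  have lim: "uniform_limit (half_plane \<epsilon>) (dirichlet_partial_sum c')
      (\<lambda>s. b * dirichlet_series c (s + of_real t) + a) sequentially" if "\<epsilon> > 0" for \<epsilon>
  proof -
    have "uniform_limit (half_plane \<epsilon>) (\<lambda>N s. dirichlet_partial_sum c N (s + of_real t))
        (\<lambda>s. dirichlet_series c (s + of_real t)) sequentially"
      by (rule uniform_limit_compose'[OF uniform_limit_dirichlet_series[of "half_plane \<epsilon>"]])
        (use unif that t in \<open>auto simp: half_plane_def\<close>)
    then have "uniform_limit (half_plane \<epsilon>) (\<lambda>N s. b * dirichlet_partial_sum c N (s + of_real t) + a)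
        (\<lambda>s. b * dirichlet_series c (s + of_real t) + a) sequentially"
      by (intro uniform_limit_add bounded_linear_uniform_limit_intros uniform_limit_const)
    then show ?thesis
    proof (rule uniform_limit_cong[THEN iffD1, rotated 2])
      show "\<forall>\<^sub>F N in sequentially. \<forall>s\<in>half_plane \<epsilon>.
          b * dirichlet_partial_sum c N (s + of_real t) + a = dirichlet_partial_sum c' N s"
        using eventually_ge_at_top[of 2] by eventually_elim (simp add: part)
    qed simp
  qed
  have "dirichlet_series c' s = b * dirichlet_series c (s + of_real t) + a" if "s \<in> half_plane 0" for s
  proof -
    have s: "Re s / 2 > 0" "s \<in> half_plane (Re s / 2)" using that by (auto simp: half_plane_def)
    from tendsto_uniform_limitI[OF lim[OF s(1)] s(2)] show ?thesis
      by (simp add: dirichlet_series_def[of c'] dirichlet_partial_sum_def[of c'] sums_def[symmetric] sums_iff)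
  qed
  with lim show ?thesis by (intro that[of c']) (auto simp: uniformly_convergent_on_def)
qed

text \<open>Convergence is uniform on \<open>half_plane t\<close> but perhaps not up to the imaginary axis, whence the
  translation.\<close>

lemma uniform_dirichlet_translate:
  assumes unif: "\<forall>\<epsilon>>0. uniformly_convergent_on (half_plane \<epsilon>) (dirichlet_partial_sum c)" and t: "t > 0"
  shows "uniform_dirichlet (\<lambda>s. dirichlet_series c (s + of_real t))"
proof (rule uniform_dirichlet_limit)
  fix e :: real assume "e > 0"
  have "uniform_limit (half_plane t) (dirichlet_partial_sum c) (dirichlet_series c) sequentially"
    by (rule uniform_limit_dirichlet_series) (use unif t in auto)
  from uniform_limitD[OF this \<open>e > 0\<close>] obtain N where
    N: "\<And>s. s \<in> half_plane t \<Longrightarrow> dist (dirichlet_partial_sum c N s) (dirichlet_series c s) < e"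
    by (auto simp: eventually_sequentially)
  have "uniform_dirichlet (\<lambda>s. \<Sum>n<N. (c n * of_real (real n powr - t)) * of_nat n powr - s)"
    by (intro uniform_dirichlet_sum uniform_dirichlet_monomial)
  also have "(\<lambda>s. \<Sum>n<N. (c n * of_real (real n powr - t)) * of_nat n powr - s)
      = (\<lambda>s. dirichlet_partial_sum c N (s + of_real t))"
    unfolding dirichlet_partial_sum_def of_nat_powr_minus_add_of_real by (simp add: mult.assoc)
  finally have "uniform_dirichlet (\<lambda>s. dirichlet_partial_sum c N (s + of_real t))" .
  moreover have "cmod (dirichlet_series c (s + of_real t) - dirichlet_partial_sum c N (s + of_real t)) < e"
    if "s \<in> half_plane 0" for s
    using N[of "s + of_real t"] that by (simp add: half_plane_def dist_norm norm_minus_commute)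
  ultimately show "\<exists>G. uniform_dirichlet G \<and> (\<forall>s\<in>half_plane 0. cmod (dirichlet_series c (s + of_real t) - G s) < e)"
    by blast
qed

text \<open>Past the starting point of the first path all additive parts have positive real part, which
  settles the case distinction in the definition by its second alternative.\<close>

lemma gordon_hedenmalm_formI:
  assumes unif: "\<forall>\<epsilon>>0. uniformly_convergent_on (half_plane \<epsilon>) (dirichlet_partial_sum c)"
    and eq: "\<And>s. s \<in> half_plane 0 \<Longrightarrow> dirichlet_series c s = \<psi> s"
    and zero: "c0 = 0 \<Longrightarrow> \<psi> ` half_plane 0 \<subseteq> half_plane (1/2)"
    and pos: "\<psi> ` half_plane 0 \<subseteq> half_plane 0"
  shows "gordon_hedenmalm_form c0 (\<lambda>s. of_nat c0 * s + \<psi> s)"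
proof -
  have im: "dirichlet_series c ` half_plane 0 = \<psi> ` half_plane 0"
    by (rule image_cong) (use eq in auto)
  have "of_nat c0 * s + \<psi> s \<in> half_plane (1/2)" if "s \<in> half_plane (1/2)" for s
  proof -
    have s: "s \<in> half_plane 0" using that by (simp add: half_plane_def)
    show ?thesis
    proof (cases "c0 = 0")
      case True
      then show ?thesis using zero s by auto
    next
      case False
      have "1/2 < Re s" using that by (simp add: half_plane_def)
      also have "1 * Re s \<le> real c0 * Re s"
        using False s by (intro mult_right_mono) (auto simp: half_plane_def)
      also have "real c0 * Re s < real c0 * Re s + Re (\<psi> s)"
        using pos s by (auto simp: half_plane_def)
      finally show ?thesis by (simp add: half_plane_def)
    qed
  qed
  moreover have "dirichlet_series c s = \<psi> s" if "s \<in> half_plane (1/2)" for s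
    using that by (intro eq) (simp add: half_plane_def)
  ultimately show ?thesis
    unfolding gordon_hedenmalm_form_def
    by (intro conjI exI[of _ c] unif impI disjI2) (use zero pos in \<open>auto simp: im\<close>)
qed

lemma gordon_hedenmalm_formE:
  assumes "gordon_hedenmalm_form c0 \<phi>"
  obtains c where "\<forall>\<epsilon>>0. uniformly_convergent_on (half_plane \<epsilon>) (dirichlet_partial_sum c)"
    "\<And>s. s \<in> half_plane (1/2) \<Longrightarrow> \<phi> s = of_nat c0 * s + dirichlet_series c s"
    "\<And>s. c0 = 0 \<Longrightarrow> s \<in> half_plane 0 \<Longrightarrow> Re (dirichlet_series c s) > 1/2"
    "\<And>s. s \<in> half_plane 0 \<Longrightarrow> Re (dirichlet_series c s) \<ge> 0"
proof -
  obtain c where c: "\<forall>\<epsilon>>0. uniformly_convergent_on (half_plane \<epsilon>) (dirichlet_partial_sum c)"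
    "\<forall>s\<in>half_plane (1/2). \<phi> s = of_nat c0 * s + dirichlet_series c s"
    and zero: "c0 = 0 \<longrightarrow> dirichlet_series c ` half_plane 0 \<subseteq> half_plane (1/2)"
    and pos: "c0 \<ge> 1 \<longrightarrow> ((\<forall>s\<in>half_plane 0. dirichlet_series c s = c 1) \<and> Re (c 1) \<ge> 0) \<or>
           dirichlet_series c ` half_plane 0 \<subseteq> half_plane 0"
    using assms unfolding gordon_hedenmalm_form_def by blast
  have z: "Re (dirichlet_series c s) > 1/2" if "c0 = 0" "s \<in> half_plane 0" for s
    using zero that unfolding half_plane_def by blast
  have "Re (dirichlet_series c s) \<ge> 0" if s: "s \<in> half_plane 0" for s
  proof (cases "c0 = 0")
    case True
    then show ?thesis using z[OF _ s] by simp
  next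
    case False
    then consider "dirichlet_series c s = c 1" "Re (c 1) \<ge> 0" | "dirichlet_series c s \<in> half_plane 0"
      using pos s by (metis image_subset_iff less_one not_le)
    then show ?thesis by cases (auto simp: half_plane_def)
  qed
  with c z show ?thesis by (intro that[of c]) blast+
qed

section \<open>The two paths\<close>

lemma compact_composition_operatorsI:
  assumes "gordon_hedenmalm_form c0 \<phi>" "is_composition_operator \<phi> T" "compact_operator T"
  shows "T \<in> compact_composition_operators c0"
  unfolding compact_composition_operators_def gordon_hedenmalm_def
  using assms characteristic_eq[OF assms(1)] by blast

lemma path_component_of_continuous:
  assumes "continuous_on {0..1::real} g" "\<And>t. t \<in> {0..1} \<Longrightarrow> g t \<in> S"
  shows "path_component S (g 0) (g 1)"
  unfolding path_component_def path_def path_image_def pathstart_def pathfinish_def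
  using assms by (intro exI[of _ g]) auto

definition compression :: "real \<Rightarrow> (hardy_dirichlet \<Rightarrow>\<^sub>L hardy_dirichlet) \<Rightarrow> hardy_dirichlet \<Rightarrow>\<^sub>L hardy_dirichlet" where
  "compression t T = translation t o\<^sub>L T o\<^sub>L translation t"

lemma compression_is_composition_operator:
  assumes "is_composition_operator \<phi> T" "t \<ge> 0"
  shows "is_composition_operator (\<lambda>s. \<phi> (s + of_real t) + of_real t) (compression t T)"
  unfolding is_composition_operator_def
proof (intro allI ballI)
  fix f s assume s: "s \<in> half_plane (1/2)"
  then have "s + of_real t \<in> half_plane (1/2)" using assms(2) by (simp add: half_plane_def)
  with assms show "eval_hd (blinfun_apply (compression t T) f) s = eval_hd f (\<phi> (s + of_real t) + of_real t)"
    by (simp add: compression_def translation.rep_eq eval_translate_hd is_composition_operator_def)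
qed

lemma compact_compression: "compact_operator T \<Longrightarrow> compact_operator (compression t T)"
  unfolding compression_def
  by (rule compact_operator_compose_contractions) (simp_all add: norm_translation_apply_le)

lemma compression_0: "compression 0 T = T"
  by (rule blinfun_eqI) (simp add: compression_def translation.rep_eq)

lemma is_composition_operator_cong:
  assumes "\<And>s. s \<in> half_plane (1/2) \<Longrightarrow> \<phi> s = \<phi>' s"
  shows "is_composition_operator \<phi> T \<longleftrightarrow> is_composition_operator \<phi>' T"
  unfolding is_composition_operator_def using assms by auto

text \<open>For \<open>t > 0\<close> the translated symbol has additive part
  \<open>\<psi> (s + t) + c0 * t + t\<close>, with real part at least \<open>t\<close>, and at least \<open>1/2 + t\<close> when
  \<open>c0 = 0\<close>. This makes the translated symbol admissible, whichever alternative of the definition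
  \<open>\<psi>\<close> satisfies.\<close>

lemma path_component_compression:
  assumes form: "gordon_hedenmalm_form c0 \<phi>" and op: "is_composition_operator \<phi> T"
    and comp: "compact_operator T"
  shows "path_component (compact_composition_operators c0) T (compression 2 T)"
proof -
  obtain c where unif: "\<forall>\<epsilon>>0. uniformly_convergent_on (half_plane \<epsilon>) (dirichlet_partial_sum c)"
    and \<phi>: "\<And>s. s \<in> half_plane (1/2) \<Longrightarrow> \<phi> s = of_nat c0 * s + dirichlet_series c s"
    and zero: "\<And>s. c0 = 0 \<Longrightarrow> s \<in> half_plane 0 \<Longrightarrow> Re (dirichlet_series c s) > 1/2"
    and pos: "\<And>s. s \<in> half_plane 0 \<Longrightarrow> Re (dirichlet_series c s) \<ge> 0"
    using gordon_hedenmalm_formE[OF form] by blast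
  have mem: "compression t T \<in> compact_composition_operators c0" if t: "t > 0" for t
  proof (rule compact_composition_operatorsI)
    define \<psi> where "\<psi> s = 1 * dirichlet_series c (s + of_real t) + of_real (real c0 * t + t)" for s
    obtain c' where c': "\<forall>\<epsilon>>0. uniformly_convergent_on (half_plane \<epsilon>) (dirichlet_partial_sum c')"
      "\<And>s. s \<in> half_plane 0 \<Longrightarrow> dirichlet_series c' s = \<psi> s"
      using affine_dirichlet_series[OF unif less_imp_le[OF t]] unfolding \<psi>_def by metis
    have shift: "s + of_real t \<in> half_plane 0" if "s \<in> half_plane 0" for s
      using that t by (simp add: half_plane_def)
    have re: "Re (\<psi> s) \<ge> Re (dirichlet_series c (s + of_real t)) + t" for s
      using t by (simp add: \<psi>_def)
    show "gordon_hedenmalm_form c0 (\<lambda>s. of_nat c0 * s + \<psi> s)"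
    proof (rule gordon_hedenmalm_formI[OF c'])
      show "\<psi> ` half_plane 0 \<subseteq> half_plane (1/2)" if "c0 = 0"
      proof (rule image_subsetI)
        fix s assume "s \<in> half_plane 0"
        from zero[OF that shift[OF this]] re[of s] t show "\<psi> s \<in> half_plane (1/2)"
          unfolding half_plane_def by simp
      qed
      show "\<psi> ` half_plane 0 \<subseteq> half_plane 0"
      proof (rule image_subsetI)
        fix s assume "s \<in> half_plane 0"
        from pos[OF shift[OF this]] re[of s] t show "\<psi> s \<in> half_plane 0"
          unfolding half_plane_def by simp
      qed
    qed
    have "\<phi> (s + of_real t) + of_real t = of_nat c0 * s + \<psi> s" if "s \<in> half_plane (1/2)" for s
      using that t \<phi>[of "s + of_real t"] by (simp add: half_plane_def \<psi>_def algebra_simps)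
    then show "is_composition_operator (\<lambda>s. of_nat c0 * s + \<psi> s) (compression t T)"
      using compression_is_composition_operator[OF op less_imp_le[OF t]]
      by (subst is_composition_operator_cong) (rule sym, assumption)
  qed (rule compact_compression[OF comp])
  have "path_component (compact_composition_operators c0) (compression (2 * 0) T) (compression (2 * 1) T)"
  proof (rule path_component_of_continuous)
    show "continuous_on {0..1} (\<lambda>t. compression (2 * t) T)"
      unfolding compression_def
      by (rule continuous_on_compose2[OF continuous_on_compression[OF comp]])
        (auto intro!: continuous_intros)
    fix t :: real assume t: "t \<in> {0..1}"
    show "compression (2 * t) T \<in> compact_composition_operators c0"
    proof (cases "t = 0")
      case True
      then show ?thesis
        using compact_composition_operatorsI[OF form op comp] by (simp add: compression_0)
    next
      case False
      then show ?thesis using mem[of "2 * t"] t by simp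
    qed
  qed
  then show ?thesis by (simp add: compression_0)
qed

text \<open>After compression by 2 the symbol is \<open>c0 * s + D s + 2\<close>; the path multiplies \<open>D\<close> by
  \<open>1 - x\<close>. The real part of the additive part stays at least 2, so every intermediate symbol is
  admissible and deep.\<close>

lemma path_component_affine_symbol:
  assumes form: "gordon_hedenmalm_form c0 \<phi>" and op: "is_composition_operator \<phi> T"
  obtains T' where "is_composition_operator (\<lambda>s. of_nat c0 * s + 2) T'"
    "path_component (compact_composition_operators c0) (compression 2 T) T'"
proof -
  obtain c where unif: "\<forall>\<epsilon>>0. uniformly_convergent_on (half_plane \<epsilon>) (dirichlet_partial_sum c)"
    and \<phi>: "\<And>s. s \<in> half_plane (1/2) \<Longrightarrow> \<phi> s = of_nat c0 * s + dirichlet_series c s"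
    and pos: "\<And>s. s \<in> half_plane 0 \<Longrightarrow> Re (dirichlet_series c s) \<ge> 0"
    by (rule gordon_hedenmalm_formE[OF form]) (rule that)
  define D where "D s = dirichlet_series c (s + of_real 2) + of_real (2 * real c0)" for s
  have D: "uniform_dirichlet D"
    unfolding D_def by (intro uniform_dirichlet_add uniform_dirichlet_translate uniform_dirichlet_const unif) simp
  have D_pos: "Re (D s) \<ge> 0" if "s \<in> half_plane 0" for s
    using pos[of "s + of_real 2"] that by (simp add: D_def half_plane_def)
  obtain R where R: "R > 0" "\<And>s. s \<in> half_plane 0 \<Longrightarrow> cmod (D s) \<le> R"
    using uniform_dirichlet_bounded[OF D] by blast
  define \<psi> where "\<psi> x s = of_real (1 - x) * D s + 2" for x :: real and s
  have deep: "Re (\<psi> x s) \<ge> 2" if "x \<in> {0..1}" "s \<in> half_plane 0" for x s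
    using that D_pos[OF that(2)] by (simp add: \<psi>_def)
  obtain A where A: "continuous_on {0..1} A" "\<And>x. x \<in> {0..1} \<Longrightarrow> compact_operator (A x)"
    "\<And>x. x \<in> {0..1} \<Longrightarrow> is_composition_operator (\<lambda>s. of_nat c0 * s + \<psi> x s) (A x)"
  proof (rule composition_operator_family[of "{0..1}" \<psi> R c0])
    show "uniform_dirichlet (\<psi> x)" for x
      unfolding \<psi>_def by (intro uniform_dirichlet_add uniform_dirichlet_mult uniform_dirichlet_const D)
    show "cmod (\<psi> x s - \<psi> y s) \<le> R * \<bar>x - y\<bar>" if "s \<in> half_plane 0" for x y s
    proof -
      have "\<psi> x s - \<psi> y s = of_real (y - x) * D s" by (simp add: \<psi>_def algebra_simps)
      also have "cmod \<dots> = \<bar>y - x\<bar> * cmod (D s)" unfolding norm_mult norm_of_real ..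
      also have "\<dots> \<le> \<bar>y - x\<bar> * R" by (intro mult_left_mono R that) simp
      finally show ?thesis by (simp add: abs_minus_commute mult.commute)
    qed
  qed (use deep R(1) in auto)
  have mem: "A x \<in> compact_composition_operators c0" if x: "x \<in> {0..1}" for x
  proof (rule compact_composition_operatorsI[OF _ A(3)[OF x] A(2)[OF x]])
    obtain c' where c': "\<forall>\<epsilon>>0. uniformly_convergent_on (half_plane \<epsilon>) (dirichlet_partial_sum c')"
      "\<And>s. s \<in> half_plane 0 \<Longrightarrow> dirichlet_series c' s
        = of_real (1 - x) * dirichlet_series c (s + of_real 2) + (of_real ((1 - x) * (2 * real c0)) + 2)"
      by (rule affine_dirichlet_series[OF unif, of 2 "of_real (1 - x)" "of_real ((1 - x) * (2 * real c0)) + 2"]) simp_all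
    show "gordon_hedenmalm_form c0 (\<lambda>s. of_nat c0 * s + \<psi> x s)"
    proof (rule gordon_hedenmalm_formI[OF c'(1)])
      show "dirichlet_series c' s = \<psi> x s" if "s \<in> half_plane 0" for s
        unfolding c'(2)[OF that] by (simp add: \<psi>_def D_def algebra_simps)
      show "\<psi> x ` half_plane 0 \<subseteq> half_plane (1/2)" "\<psi> x ` half_plane 0 \<subseteq> half_plane 0"
        using deep[OF x] by (fastforce simp: half_plane_def)+
    qed
  qed
  have "A 0 = compression 2 T"
  proof (rule composition_operator_unique[OF A(3)])
    show "is_composition_operator (\<lambda>s. \<phi> (s + of_real 2) + of_real 2) (compression 2 T)"
      by (rule compression_is_composition_operator[OF op]) simp
    show "of_nat c0 * s + \<psi> 0 s = \<phi> (s + of_real 2) + of_real 2" if "s \<in> half_plane (1/2)" for s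
      using that \<phi>[of "s + of_real 2"] by (simp add: half_plane_def \<psi>_def D_def algebra_simps)
  qed simp
  moreover have "path_component (compact_composition_operators c0) (A 0) (A 1)"
    by (rule path_component_of_continuous[OF A(1) mem])
  moreover have "is_composition_operator (\<lambda>s. of_nat c0 * s + 2) (A 1)"
    using A(3)[of 1] by (simp add: \<psi>_def)
  ultimately show ?thesis by (intro that[of "A 1"]) simp_all
qed

theorem theorem3p5:
  fixes c0 :: nat
  shows "path_connected (compact_composition_operators c0)"
proof -
  let ?S = "compact_composition_operators c0"
  have "\<exists>T'. is_composition_operator (\<lambda>s. of_nat c0 * s + 2) T' \<and> path_component ?S T T'" if T: "T \<in> ?S" for T
  proof -
    obtain \<phi> where \<phi>: "\<phi> \<in> gordon_hedenmalm" "characteristic \<phi> = c0"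
      and op: "is_composition_operator \<phi> T" and comp: "compact_operator T"
      using T unfolding compact_composition_operators_def by blast
    then have form: "gordon_hedenmalm_form c0 \<phi>"
      using characteristic_eq unfolding gordon_hedenmalm_def by auto
    obtain T' where "is_composition_operator (\<lambda>s. of_nat c0 * s + 2) T'"
      "path_component ?S (compression 2 T) T'"
      by (rule path_component_affine_symbol[OF form op])
    with path_component_compression[OF form op comp] show ?thesis
      using path_component_trans by blast
  qed
  then obtain E where E: "\<And>T. T \<in> ?S \<Longrightarrow> is_composition_operator (\<lambda>s. of_nat c0 * s + 2) (E T)"
    "\<And>T. T \<in> ?S \<Longrightarrow> path_component ?S T (E T)"
    by metis
  have "E T = E T'" if "T \<in> ?S" "T' \<in> ?S" for T T'
    by (rule composition_operator_unique[OF E(1)[OF that(1)] E(1)[OF that(2)]]) (rule refl)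
  then show ?thesis
    unfolding path_connected_component
    by (metis E(2) path_component_sym path_component_trans)
qed

end
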